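(* Let $|\phi_1\rangle^{ABEF}$ and $|\phi_2\rangle^{ABEF}$ be purifications of $\rho_1,\rho_2\in\mathcal{S}_{\rm all}$ (states on $ABE$), respectively, and let $\mathcal{U}_{\rm SWAP}^{EF}$ be the swap operation of $E$ and $F$. If $$\mathcal{U}_{\rm SWAP}^{EF}(|\phi_1\rangle\langle\phi_1|)=|\phi_2\rangle\langle\phi_2|,$$ then $$I_\downarrow(\rho_1)=I_\downarrow^*(\rho_2),\qquad J_\downarrow(\rho_1)=J_\downarrow^*(\rho_2).$$ Under the same condition, we also have $$\rho_1\in\mathcal{S}_I\ \Leftrightarrow\ \rho_2\in\mathcal{S}_I^*,\qquad \rho_1\in\mathcal{S}_J\ \Leftrightarrow\ \rho_2\in\mathcal{S}_J^*.$$
   Context: All Hilbert spaces are finite-dimensional. A quantum operation is a linear CPTP map; its input and output spaces may differ. Maps act as the identity on systems not mentioned, and linear isometries $\mathcal{W}$ are identified with the maps they induce on states. $\mathcal{S}_{\rm all}$ is the set of all density operators on $\mathcal{H}^A\otimes\mathcal{H}^B\otimes\mathcal{H}^E$, for arbitrary finite-dimensional spaces. Superscripts on a state denote the corresponding reduced state. Auxiliary systems $F,F_A,F_B,E_A,E_B$ are arbitrary finite-dimensional. The swap operation exchanges the content of $E$ and $F$ (if $E$ and $F$ have different dimensions for $\phi_1$, then the spaces playing the roles of $E$ and $F$ for $\phi_2$ are those playing the roles of $F$ and $E$ for $\phi_1$). An extension of $\rho^{ABE}$ is a state $\varrho^{ABEF}$ with ${\rm Tr}_F[\varrho^{ABEF}]=\rho^{ABE}$.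 $I(A:B|E)_\rho:=S(AE)_\rho+S(BE)_\rho-S(ABE)_\rho-S(E)_\rho$, with $S$ the von Neumann entropy. $\mathcal{S}_{\rm Markov}$ is the set of states on $ABE$ with $I(A:B|E)=0$; $\mathcal{S}_{\rm Markov}^{A:B|F}$ is the set of states on $ABF$ with $I(A:B|F)=0$. $\mathcal{S}_{\rm sep}^{X:Y}$ is the set of separable states between $X$ and $Y$. $\mathbb{L}_E$ is the set of all quantum operations on $E$. Functions of $\rho\in\mathcal{S}_{\rm all}$: - $I_\downarrow(\rho):=\inf_{\mathcal{T}\in\mathbb{L}_E}I(A:B|E)_{\mathcal{T}(\rho)}$. - $I_\downarrow^*(\rho):=\inf_{\varrho}I(A:B|F)_{\varrho}$, over all extensions $\varrho^{ABEF}$ of $\rho^{ABE}$. - $J_\downarrow(\rho):=\inf_{\phi_\rho}\inf_{\mathcal{T}\in\mathbb{L}_E}I(AF_A:BF_B|E)_{\mathcal{T}(\phi_\rho)}$, over all purifications $|\phi_\rho\rangle^{ABEF_AF_B}$ of $\rho^{ABE}$. - $J_\downarrow^*(\rho):=\inf_{\mathcal{W}}\inf_{\varrho}I(AE_A:BE_B|F)_{\mathcal{W}(\varrho)}$, over all linear isometries $\mathcal{W}:E\to E_AE_B$ and all extensions $\varrho^{ABEF}$ of $\rho^{ABE}$. Sets: - $\mathcal{S}_I:=\{\rho\in\mathcal{S}_{\rm all}\mid\exists\mathcal{T}\in\mathbb{L}_E:\ \mathcal{T}(\rho)\in\mathcal{S}_{\rm Markov}\}$. - $\mathcal{S}_I^*:=\{\rho\in\mathcal{S}_{\rm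 all}\mid\exists\text{ a state }\varrho^{ABEF}:\ \varrho^{ABE}=\rho^{ABE},\ \varrho^{ABF}\in\mathcal{S}_{\rm Markov}^{A:B|F}\}$. - $\mathcal{S}_J^*:=\{\rho\in\mathcal{S}_{\rm all}\mid\exists\text{ a linear isometry }\mathcal{W}:E\to E_AE_B:\ \mathcal{W}(\rho^{ABE})\in\mathcal{S}_{\rm sep}^{AE_A:BE_B}\}$. - $\mathcal{S}_J:=\{\rho\in\mathcal{S}_{\rm all}\mid\exists\text{ a purification }|\phi_\rho\rangle^{ABEF_AF_B}\text{ of }\rho^{ABE}:\ \phi_\rho^{ABF_AF_B}\in\mathcal{S}_{\rm sep}^{AF_A:BF_B}\}$. *)

theory Defs
  imports
    "Jordan_Normal_Form.Char_Poly"
    "HOL-Library.Complex_Order"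
    "HOL-Library.Countable_Set"
    "HOL-Library.Extended_Real"
begin

section \<open>Operators on finite-dimensional Hilbert spaces\<close>

text \<open>
  A Hilbert space of dimension \<open>d\<close> is \<open>\<complex>\<^sup>d\<close>, with basis indexed by \<open>{..<d}\<close>. A composite system is
  indexed by the product of the index sets of its parts, so that tensor factors stay visible as
  components of tuples. Vectors and operators on the space with index set \<open>X\<close> are functions that
  vanish off \<open>X\<close>; an operator \<open>\<rho>\<close> has matrix entries \<open>\<rho> i j\<close> (row \<open>i\<close>, column \<open>j\<close>).
\<close>

type_synonym 'i ket = "'i \<Rightarrow> complex"
type_synonym 'i op = "'i \<Rightarrow> 'i \<Rightarrow> complex"

definition operators :: "'i set \<Rightarrow> 'i op set" where
  "operators X = {\<rho>. \<forall>i j. \<rho> i j \<noteq> 0 \<longrightarrow> i \<in> X \<and> j \<in> X}"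

definition op_trace :: "'i set \<Rightarrow> 'i op \<Rightarrow> complex" where
  "op_trace X \<rho> = (\<Sum>i\<in>X. \<rho> i i)"

text \<open>In the order on \<^typ>\<open>complex\<close>, \<open>0 \<le> z\<close> means that \<open>z\<close> is real and nonnegative.\<close>

definition positive_ops :: "'i set \<Rightarrow> 'i op set" where
  "positive_ops X =
     {\<rho> \<in> operators X. \<forall>v. 0 \<le> (\<Sum>i\<in>X. \<Sum>j\<in>X. cnj (v i) * \<rho> i j * v j)}"

definition density_ops :: "'i set \<Rightarrow> 'i op set" where
  "density_ops X = {\<rho> \<in> positive_ops X. op_trace X \<rho> = 1}"

definition unit_kets :: "'i set \<Rightarrow> 'i ket set" where
  "unit_kets X = {\<psi>. (\<forall>i. \<psi> i \<noteq> 0 \<longrightarrow> i \<in> X) \<and> (\<Sum>i\<in>X. (cmod (\<psi> i))\<^sup>2) = 1}"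

text \<open>The projector \<open>|\<psi>\<rangle>\<langle>\<psi>|\<close>.\<close>

definition proj :: "'i ket \<Rightarrow> 'i op" where
  "proj \<psi> = (\<lambda>i j. \<psi> i * cnj (\<psi> j))"

text \<open>
  Reordering and regrouping of tensor factors: if \<open>g\<close> is a bijection from the new index set to the
  old one, then \<open>relabel g\<close> is conjugation by the corresponding permutation unitary.
\<close>

definition relabel :: "('j \<Rightarrow> 'i) \<Rightarrow> 'i op \<Rightarrow> 'j op" where
  "relabel g \<rho> = (\<lambda>i j. \<rho> (g i) (g j))"

text \<open>
  Partial trace: \<open>Z\<close> indexes the system that is traced out, and \<open>g i z\<close> is the index of the full
  system whose remaining part is \<open>i\<close> and whose traced-out part is \<open>z\<close>.
\<close>

definition ptrace :: "('i \<Rightarrow> 'z \<Rightarrow> 'j) \<Rightarrow> 'z set \<Rightarrow> 'j op \<Rightarrow> 'i op" where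
  "ptrace g Z \<rho> = (\<lambda>i j. \<Sum>z\<in>Z. \<rho> (g i z) (g j z))"

section \<open>Quantum operations\<close>

text \<open>
  The map \<open>id \<otimes> \<Phi>\<close>: an operator on a product space is a block matrix indexed by the first factor,
  and \<open>\<Phi>\<close> acts on each block.
\<close>

definition id_tensor :: "('s op \<Rightarrow> 't op) \<Rightarrow> ('r \<times> 's) op \<Rightarrow> ('r \<times> 't) op" where
  "id_tensor \<Phi> \<rho> = (\<lambda>(r, s) (r', s'). \<Phi> (\<lambda>u v. \<rho> (r, u) (r', v)) s s')"

definition linear_on_ops :: "'s set \<Rightarrow> 't set \<Rightarrow> ('s op \<Rightarrow> 't op) \<Rightarrow> bool" where
  "linear_on_ops X Y \<Phi> \<longleftrightarrow>
     (\<forall>\<sigma>\<in>operators X. \<Phi> \<sigma> \<in> operators Y) \<and>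
     (\<forall>\<sigma>\<in>operators X. \<forall>\<tau>\<in>operators X. \<Phi> (\<lambda>i j. \<sigma> i j + \<tau> i j) = (\<lambda>i j. \<Phi> \<sigma> i j + \<Phi> \<tau> i j)) \<and>
     (\<forall>\<sigma>\<in>operators X. \<forall>c. \<Phi> (\<lambda>i j. c * \<sigma> i j) = (\<lambda>i j. c * \<Phi> \<sigma> i j))"

definition completely_positive :: "'s set \<Rightarrow> 't set \<Rightarrow> ('s op \<Rightarrow> 't op) \<Rightarrow> bool" where
  "completely_positive X Y \<Phi> \<longleftrightarrow>
     (\<forall>k::nat. \<forall>\<rho>\<in>positive_ops ({..<k} \<times> X). id_tensor \<Phi> \<rho> \<in> positive_ops ({..<k} \<times> Y))"

definition trace_preserving :: "'s set \<Rightarrow> 't set \<Rightarrow> ('s op \<Rightarrow> 't op) \<Rightarrow> bool" where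
  "trace_preserving X Y \<Phi> \<longleftrightarrow> (\<forall>\<sigma>\<in>operators X. op_trace Y (\<Phi> \<sigma>) = op_trace X \<sigma>)"

definition quantum_operation :: "'s set \<Rightarrow> 't set \<Rightarrow> ('s op \<Rightarrow> 't op) \<Rightarrow> bool" where
  "quantum_operation X Y \<Phi> \<longleftrightarrow>
     linear_on_ops X Y \<Phi> \<and> completely_positive X Y \<Phi> \<and> trace_preserving X Y \<Phi>"

text \<open>
  All quantum operations on a system of dimension \<open>e\<close>, each paired with the (arbitrary) dimension of
  its output space.
\<close>

definition quantum_ops_on :: "nat \<Rightarrow> (nat \<times> (nat op \<Rightarrow> nat op)) set" where
  "quantum_ops_on e = {(e', T). quantum_operation {..<e} {..<e'} T}"

text \<open>Linear isometries are kernels \<open>W t s\<close> with \<open>W\<^sup>* W = 1\<close>; the map they induce is \<open>\<sigma> \<mapsto> W \<sigma> W\<^sup>*\<close>.\<close>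

definition isometries :: "'s set \<Rightarrow> 't set \<Rightarrow> ('t \<Rightarrow> 's \<Rightarrow> complex) set" where
  "isometries X Y =
     {W. (\<forall>t s. W t s \<noteq> 0 \<longrightarrow> t \<in> Y \<and> s \<in> X) \<and>
         (\<forall>s\<in>X. \<forall>s'\<in>X. (\<Sum>t\<in>Y. cnj (W t s) * W t s') = (if s = s' then 1 else 0))}"

definition induced_map :: "'s set \<Rightarrow> ('t \<Rightarrow> 's \<Rightarrow> complex) \<Rightarrow> 's op \<Rightarrow> 't op" where
  "induced_map X W \<sigma> = (\<lambda>t t'. \<Sum>s\<in>X. \<Sum>s'\<in>X. W t s * \<sigma> s s' * cnj (W t' s'))"

section \<open>Entropy, conditional mutual information, separability\<close>

text \<open>
  The von Neumann entropy \<open>- Tr (\<rho> log \<rho>)\<close> is evaluated on the eigenvalues of \<open>\<rho>\<close>, counted with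
  multiplicity; \<open>0 log 0 = 0\<close> holds because the factor \<open>0\<close> annihilates. The order in which the
  index set is enumerated does not affect the characteristic polynomial.
\<close>

definition matrix_of :: "'i set \<Rightarrow> 'i op \<Rightarrow> complex mat" where
  "matrix_of X \<rho> =
     mat (card X) (card X) (\<lambda>(m, n). \<rho> (from_nat_into X m) (from_nat_into X n))"

definition entropy :: "'i set \<Rightarrow> 'i op \<Rightarrow> real" where
  "entropy X \<rho> = - (\<Sum>r\<in>#proots (char_poly (matrix_of X \<rho>)). Re r * log 2 (Re r))"

text \<open>\<open>I(X:Y|Z) = S(XZ) + S(YZ) - S(XYZ) - S(Z)\<close>\<close>

definition cmi :: "'x set \<Rightarrow> 'y set \<Rightarrow> 'z set \<Rightarrow> ('x \<times> 'y \<times> 'z) op \<Rightarrow> real" where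
  "cmi X Y Z \<rho> =
     entropy (X \<times> Z) (ptrace (\<lambda>(x, z) y. (x, y, z)) Y \<rho>)
     + entropy (Y \<times> Z) (ptrace (\<lambda>(y, z) x. (x, y, z)) X \<rho>)
     - entropy (X \<times> Y \<times> Z) \<rho>
     - entropy Z (ptrace (\<lambda>z (x, y). (x, y, z)) (X \<times> Y) \<rho>)"

definition separable_states :: "'x set \<Rightarrow> 'y set \<Rightarrow> ('x \<times> 'y) op set" where
  "separable_states X Y =
     {\<rho>. \<exists>(n::nat) p \<sigma> \<tau>.
        (\<forall>k<n. 0 \<le> p k \<and> \<sigma> k \<in> density_ops X \<and> \<tau> k \<in> density_ops Y) \<and>
        (\<Sum>k<n. p k) = (1::real) \<and>
        \<rho> = (\<lambda>(x, y) (x', y'). \<Sum>k<n. of_real (p k) * \<sigma> k x x' * \<tau> k y y')}"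

section \<open>States on ABE, purifications and extensions\<close>

text \<open>
  Throughout, \<open>a b e\<close> are the dimensions of the systems \<open>A B E\<close>. Since an operator does not record
  the dimensions of its systems, they are parameters of all sets and functions of states.
\<close>

definition S_all :: "nat \<Rightarrow> nat \<Rightarrow> nat \<Rightarrow> (nat \<times> nat \<times> nat) op set" where
  "S_all a b e = density_ops ({..<a} \<times> {..<b} \<times> {..<e})"

definition S_Markov :: "nat \<Rightarrow> nat \<Rightarrow> nat \<Rightarrow> (nat \<times> nat \<times> nat) op set" where
  "S_Markov a b e = {\<rho> \<in> S_all a b e. cmi {..<a} {..<b} {..<e} \<rho> = 0}"

text \<open>The purifying system may be composite, so it is given by its index set \<open>F\<close>.\<close>

definition purifications ::
  "nat \<Rightarrow> nat \<Rightarrow> nat \<Rightarrow> 'f set \<Rightarrow> (nat \<times> nat \<times> nat) op \<Rightarrow> (nat \<times> nat \<times> nat \<times> 'f) ket set" where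
  "purifications a b e F \<rho> =
     {\<psi> \<in> unit_kets ({..<a} \<times> {..<b} \<times> {..<e} \<times> F).
        ptrace (\<lambda>(i, j, k) l. (i, j, k, l)) F (proj \<psi>) = \<rho>}"

definition extensions ::
  "nat \<Rightarrow> nat \<Rightarrow> nat \<Rightarrow> nat \<Rightarrow> (nat \<times> nat \<times> nat) op \<Rightarrow> (nat \<times> nat \<times> nat \<times> nat) op set" where
  "extensions a b e f \<rho> =
     {\<omega> \<in> density_ops ({..<a} \<times> {..<b} \<times> {..<e} \<times> {..<f}).
        ptrace (\<lambda>(i, j, k) l. (i, j, k, l)) {..<f} \<omega> = \<rho>}"

text \<open>The swap operation of \<open>E\<close> and \<open>F\<close>, mapping \<open>|i j k l\<rangle>\<close> to \<open>|i j l k\<rangle>\<close>.\<close>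

definition swap_EF :: "(nat \<times> nat \<times> nat \<times> nat) op \<Rightarrow> (nat \<times> nat \<times> nat \<times> nat) op" where
  "swap_EF = relabel (\<lambda>(i, j, l, k). (i, j, k, l))"

section \<open>The four functions\<close>

text \<open>
  Infima are taken in the extended reals, where they need no side condition of being bounded below.
  In the tuples, \<open>i j k\<close> index \<open>A B E\<close>, \<open>l\<close> indexes \<open>F\<close>, and \<open>x y\<close> index \<open>F\<^sub>A F\<^sub>B\<close> or
  \<open>E\<^sub>A E\<^sub>B\<close>.
\<close>

definition apply_E ::
  "(nat op \<Rightarrow> 't op) \<Rightarrow> (nat \<times> nat \<times> nat) op \<Rightarrow> (nat \<times> nat \<times> 't) op" where
  "apply_E T \<rho> =
     relabel (\<lambda>(i, j, k). ((i, j), k)) (id_tensor T (relabel (\<lambda>((i, j), k). (i, j, k)) \<rho>))"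

definition apply_E_4 ::
  "(nat op \<Rightarrow> 't op) \<Rightarrow> (nat \<times> nat \<times> nat \<times> 'f) op \<Rightarrow> (nat \<times> nat \<times> 't \<times> 'f) op" where
  "apply_E_4 T \<rho> =
     relabel (\<lambda>(i, j, k, l). ((i, j, l), k))
       (id_tensor T (relabel (\<lambda>((i, j, l), k). (i, j, k, l)) \<rho>))"

definition I_down :: "nat \<Rightarrow> nat \<Rightarrow> nat \<Rightarrow> (nat \<times> nat \<times> nat) op \<Rightarrow> ereal" where
  "I_down a b e \<rho> =
     (INF (e', T) \<in> quantum_ops_on e. ereal (cmi {..<a} {..<b} {..<e'} (apply_E T \<rho>)))"

definition I_down_star :: "nat \<Rightarrow> nat \<Rightarrow> nat \<Rightarrow> (nat \<times> nat \<times> nat) op \<Rightarrow> ereal" where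
  "I_down_star a b e \<rho> =
     (INF (f, \<omega>) \<in> {(f, \<omega>). \<omega> \<in> extensions a b e f \<rho>}.
        ereal (cmi {..<a} {..<b} {..<f} (ptrace (\<lambda>(i, j, l) k. (i, j, k, l)) {..<e} \<omega>)))"

definition J_down :: "nat \<Rightarrow> nat \<Rightarrow> nat \<Rightarrow> (nat \<times> nat \<times> nat) op \<Rightarrow> ereal" where
  "J_down a b e \<rho> =
     (INF (fa, fb, \<psi>) \<in> {(fa::nat, fb::nat, \<psi>). \<psi> \<in> purifications a b e ({..<fa} \<times> {..<fb}) \<rho>}.
      INF (e', T) \<in> quantum_ops_on e.
        ereal (cmi ({..<a} \<times> {..<fa}) ({..<b} \<times> {..<fb}) {..<e'}
          (relabel (\<lambda>((i, x), (j, y), k). (i, j, k, x, y)) (apply_E_4 T (proj \<psi>)))))"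

definition J_down_star :: "nat \<Rightarrow> nat \<Rightarrow> nat \<Rightarrow> (nat \<times> nat \<times> nat) op \<Rightarrow> ereal" where
  "J_down_star a b e \<rho> =
     (INF (ea, eb, W) \<in> {(ea::nat, eb::nat, W). W \<in> isometries {..<e} ({..<ea} \<times> {..<eb})}.
      INF (f, \<omega>) \<in> {(f, \<omega>). \<omega> \<in> extensions a b e f \<rho>}.
        ereal (cmi ({..<a} \<times> {..<ea}) ({..<b} \<times> {..<eb}) {..<f}
          (relabel (\<lambda>((i, x), (j, y), l). (i, j, (x, y), l))
            (apply_E_4 (induced_map {..<e} W) \<omega>))))"

section \<open>The four sets\<close>

definition S_I :: "nat \<Rightarrow> nat \<Rightarrow> nat \<Rightarrow> (nat \<times> nat \<times> nat) op set" where
  "S_I a b e = {\<rho> \<in> S_all a b e. \<exists>(e', T) \<in> quantum_ops_on e. apply_E T \<rho> \<in> S_Markov a b e'}"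

definition S_I_star :: "nat \<Rightarrow> nat \<Rightarrow> nat \<Rightarrow> (nat \<times> nat \<times> nat) op set" where
  "S_I_star a b e =
     {\<rho> \<in> S_all a b e. \<exists>f. \<exists>\<omega> \<in> extensions a b e f \<rho>.
        ptrace (\<lambda>(i, j, l) k. (i, j, k, l)) {..<e} \<omega> \<in> S_Markov a b f}"

definition S_J_star :: "nat \<Rightarrow> nat \<Rightarrow> nat \<Rightarrow> (nat \<times> nat \<times> nat) op set" where
  "S_J_star a b e =
     {\<rho> \<in> S_all a b e. \<exists>(ea::nat) (eb::nat). \<exists>W \<in> isometries {..<e} ({..<ea} \<times> {..<eb}).
        relabel (\<lambda>((i, x), (j, y)). (i, j, x, y)) (apply_E (induced_map {..<e} W) \<rho>)
          \<in> separable_states ({..<a} \<times> {..<ea}) ({..<b} \<times> {..<eb})}"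

definition S_J :: "nat \<Rightarrow> nat \<Rightarrow> nat \<Rightarrow> (nat \<times> nat \<times> nat) op set" where
  "S_J a b e =
     {\<rho> \<in> S_all a b e. \<exists>(fa::nat) (fb::nat). \<exists>\<psi> \<in> purifications a b e ({..<fa} \<times> {..<fb}) \<rho>.
        ptrace (\<lambda>((i, x), (j, y)) k. (i, j, k, x, y)) {..<e} (proj \<psi>)
          \<in> separable_states ({..<a} \<times> {..<fa}) ({..<b} \<times> {..<fb})}"

end

theory Submission
  imports Defs
begin

text \<open>
  Let \<open>\<phi>\<close> be the common pure state on \<open>ABEF\<close>. A quantum operation \<open>T\<close> on \<open>E\<close> turns \<open>\<phi>\<close> into an
  extension of \<open>\<rho>\<^sub>2\<close>, and every extension arises in this way: purify it, use the unitary freedom of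
  purifications to write the result as an isometry applied to \<open>E\<close>, and trace out the purifying
  system. Dually, an isometry on \<open>F\<close> turns \<open>\<phi>\<close> into a purification of \<open>\<rho>\<^sub>1\<close>, and every
  purification arises in this way once \<open>F\<^sub>A\<close> is enlarged enough to make room for an isometry, which
  changes neither entropies nor separability. Both correspondences preserve the states on which
  the conditional mutual information is evaluated, because maps on \<open>E\<close> and on \<open>F\<close> commute.
\<close>

section \<open>Positive semidefinite matrices\<close>

text \<open>The E side and the F side are not treated alike. Two purifications of one state are
  related by a partial isometry, determined only on the support of the reduced state of the
  purifying system; completing it to an isometry costs as many extra dimensions as the source has.
  For an extension of \<open>\<rho>\<^sub>2\<close> these go into the environment and disappear
  under the trace. For a purification of \<open>\<rho>\<^sub>1\<close> they enlarge
  \<open>F\<^sub>A\<close>, which stays visible: no isometry into the given \<open>F\<^sub>A\<close>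
  and \<open>F\<^sub>B\<close> need exist, since their joint dimension may be smaller than that of
  \<open>F\<close>. Hence conditional mutual information and separability have to be compared across
  spaces of different dimension. Invariance under adding zero eigenvalues is the only property of
  entropy that enters. Apart from it both sides are evaluated on literally the same operators, so
  the two infima range over the same values, whether or not they are attained.\<close>

definition psd :: "'i set \<Rightarrow> 'i op \<Rightarrow> bool" where
  "psd X \<rho> \<longleftrightarrow> (\<forall>v. 0 \<le> (\<Sum>i\<in>X. \<Sum>j\<in>X. cnj (v i) * \<rho> i j * v j))"

text \<open>Separating positivity from the support condition lets it be tested on any index set,
  restricted to subsets, and compared entrywise on \<open>X\<close> alone.\<close>

lemma positive_ops_iff_psd: "\<rho> \<in> positive_ops X \<longleftrightarrow> \<rho> \<in> operators X \<and> psd X \<rho>"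
  by (simp add: positive_ops_def psd_def)

lemma psdD: "psd X \<rho> \<Longrightarrow> 0 \<le> (\<Sum>i\<in>X. \<Sum>j\<in>X. cnj (v i) * \<rho> i j * v j)"
  by (simp add: psd_def)

lemma psd_subset:
  assumes "finite Y" "X \<subseteq> Y" "psd Y \<rho>"
  shows "psd X \<rho>"
  unfolding psd_def
proof
  fix v
  let ?v = "\<lambda>i. if i \<in> X then v i else (0::complex)"
  have "0 \<le> (\<Sum>i\<in>Y. \<Sum>j\<in>Y. cnj (?v i) * \<rho> i j * ?v j)"
    using assms(3) by (rule psdD)
  also have "\<dots> = (\<Sum>i\<in>X. \<Sum>j\<in>X. cnj (v i) * \<rho> i j * v j)"
    using assms(1,2) by (intro sum.mono_neutral_cong_right sum.cong) (auto intro!: sum.neutral)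
  finally show "0 \<le> (\<Sum>i\<in>X. \<Sum>j\<in>X. cnj (v i) * \<rho> i j * v j)" .
qed

lemma psd_superset:
  assumes "finite Y" "X \<subseteq> Y" "psd X \<rho>" "\<rho> \<in> operators X"
  shows "psd Y \<rho>"
  unfolding psd_def
proof
  fix v
  have "\<rho> i j = 0" if "i \<notin> X \<or> j \<notin> X" for i j
    using assms(4) that by (auto simp: operators_def)
  then have "(\<Sum>i\<in>Y. \<Sum>j\<in>Y. cnj (v i) * \<rho> i j * v j) = (\<Sum>i\<in>X. \<Sum>j\<in>X. cnj (v i) * \<rho> i j * v j)"
    using assms(1,2) by (intro sum.mono_neutral_cong_right) (auto intro!: sum.neutral sum.mono_neutral_right)
  then show "0 \<le> (\<Sum>i\<in>Y. \<Sum>j\<in>Y. cnj (v i) * \<rho> i j * v j)"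
    using psdD[OF assms(3), of v] by simp
qed

lemma psd_diag:
  assumes "finite X" "i \<in> X" "psd X \<rho>"
  shows "0 \<le> \<rho> i i"
proof -
  have "psd {i} \<rho>"
    using psd_subset[of X "{i}"] assms by simp
  from psdD[OF this, of "\<lambda>_. 1"] show ?thesis by simp
qed

lemma psd_pair:
  assumes "finite X" "i \<in> X" "j \<in> X" "i \<noteq> j" "psd X \<rho>"
  shows "0 \<le> cnj \<alpha> * \<rho> i i * \<alpha> + cnj \<alpha> * \<rho> i j * \<beta> + cnj \<beta> * \<rho> j i * \<alpha> + cnj \<beta> * \<rho> j j * \<beta>"
proof -
  have "psd {i, j} \<rho>"
    using psd_subset[of X "{i, j}"] assms by simp
  from psdD[OF this, of "\<lambda>k. if k = i then \<alpha> else \<beta>"] show ?thesis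
    using assms(4) by (simp add: add.assoc)
qed

text \<open>In the order on complex numbers positivity includes being real. The test vectors (1, 1)
  and (1, i) make the sum of the two off-diagonal entries real and their difference
  imaginary.\<close>

lemma psd_hermitian:
  assumes "finite X" "i \<in> X" "j \<in> X" "psd X \<rho>"
  shows "\<rho> j i = cnj (\<rho> i j)"
proof (cases "i = j")
  case True
  then show ?thesis
    using psd_diag[OF assms(1,2,4)] by (simp add: less_eq_complex_def complex_eq_iff)
next
  case False
  have d: "Im (\<rho> i i) = 0" "Im (\<rho> j j) = 0"
    using psd_diag[OF assms(1,2,4)] psd_diag[OF assms(1,3,4)] by (simp_all add: less_eq_complex_def)
  show ?thesis
    using psd_pair[OF assms(1-3) False assms(4), of 1 1]
      psd_pair[OF assms(1-3) False assms(4), of 1 \<i>] d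
    by (simp add: less_eq_complex_def complex_eq_iff)
qed

text \<open>On the test vector with entries \<open>- s * z\<close> and 1 the form equals
  \<open>\<rho> j j\<close> minus \<open>2 * s\<close> times the squared modulus of
  \<open>z\<close>. It is affine in \<open>s\<close> and would be unbounded below if
  \<open>z\<close> were nonzero.\<close>

lemma psd_zero_diag:
  assumes "finite X" "i \<in> X" "j \<in> X" "psd X \<rho>" "\<rho> i i = 0"
  shows "\<rho> i j = 0"
proof (cases "i = j")
  case True
  then show ?thesis using assms(5) by simp
next
  case False
  define z where "z = \<rho> i j"
  have h: "\<rho> j i = cnj z"
    using psd_hermitian[OF assms(1-4)] by (simp add: z_def)
  have "0 \<le> Re (\<rho> j j) - 2 * s * (cmod z)\<^sup>2" for s :: real
  proof -
    have "0 \<le> Re (cnj (- of_real s * z) * z + cnj z * (- of_real s * z) + \<rho> j j)"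
      using psd_pair[OF assms(1-3) False assms(4), of "- of_real s * z" 1] h assms(5)
      by (simp add: less_eq_complex_def z_def)
    then show ?thesis
      unfolding cmod_power2 by (simp add: algebra_simps power2_eq_square)
  qed
  \<comment> \<open>This \<open>s\<close> turns the lower bound into \<open>0 \<le> - 1\<close>
    unless \<open>z = 0\<close>.\<close>
  from this[of "(Re (\<rho> j j) + 1) / (2 * (cmod z)\<^sup>2)"] have "z = 0"
    by (cases "z = 0") (auto simp: field_simps)
  then show ?thesis by (simp add: z_def)
qed

text \<open>Cholesky factorisation: a nonzero pivot at \<open>x\<close> splits off one rank-one
  term, and the induction hypothesis factors the Schur complement. It serves in place of a spectral
  decomposition; \<open>n\<close> later becomes the dimension of a system purifying an
  extension.\<close>

lemma psd_decomposition:
  assumes "finite X" "psd X \<rho>"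
  shows "\<exists>(n::nat) u. \<forall>i\<in>X. \<forall>j\<in>X. \<rho> i j = (\<Sum>g<n. u g i * cnj (u g j))"
  using assms
proof (induction X arbitrary: \<rho> rule: finite_induct)
  case empty
  then show ?case by simp
next
  case (insert x X)
  note fin = finite.insertI[OF insert.hyps(1), of x]
  have herm: "\<rho> j i = cnj (\<rho> i j)" if "i \<in> insert x X" "j \<in> insert x X" for i j
    using psd_hermitian[OF fin that insert.prems] .
  have diag: "0 \<le> \<rho> x x"
    using psd_diag[OF fin _ insert.prems] by simp
  show ?case
  proof (cases "\<rho> x x = 0")
    case True
    have z: "\<rho> x j = 0" if "j \<in> insert x X" for j
      using psd_zero_diag[OF fin _ that insert.prems True] by simp
    have z': "\<rho> j x = 0" if "j \<in> insert x X" for j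
      using herm[of x j] z[OF that] that by simp
    obtain n :: nat and u where u: "\<forall>i\<in>X. \<forall>j\<in>X. \<rho> i j = (\<Sum>g<n. u g i * cnj (u g j))"
      using insert.IH[OF psd_subset[OF fin subset_insertI insert.prems]] by blast
    let ?u = "\<lambda>(g::nat) i. if i = x then 0 else u g i"
    have "\<rho> i j = (\<Sum>g<n. ?u g i * cnj (?u g j))" if "i \<in> insert x X" "j \<in> insert x X" for i j
      using that u z[of j] z'[of i] insert.hyps(2) by (cases "i = x"; cases "j = x") auto
    then show ?thesis by (intro exI[of _ n] exI[of _ ?u]) blast
  next
    case False
    define d where "d = \<rho> x x"
    have d: "d \<noteq> 0" "d = of_real (Re d)" "0 < Re d" "cnj d = d"
      using False diag unfolding d_def by (auto simp: less_eq_complex_def complex_eq_iff)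
    define \<sigma> where "\<sigma> = (\<lambda>i j. \<rho> i j - \<rho> i x * \<rho> x j / d)"
    \<comment> \<open>The Schur complement is positive: complete \<open>v\<close> by the minimising entry \<open>q\<close> at \<open>x\<close>.\<close>
    have "psd X \<sigma>"
      unfolding psd_def
    proof
      fix v
      define s where "s = (\<Sum>j\<in>X. \<rho> x j * v j)"
      have s': "(\<Sum>i\<in>X. cnj (v i) * \<rho> i x) = cnj s"
        unfolding s_def cnj_sum by (intro sum.cong) (auto simp: herm[of x])
      define q where "q = - s / d"
      let ?v = "\<lambda>i. if i = x then q else v i"
      have "0 \<le> (\<Sum>i\<in>insert x X. \<Sum>j\<in>insert x X. cnj (?v i) * \<rho> i j * ?v j)"
        using insert.prems by (rule psdD)
      also have "\<dots> = cnj q * d * q + cnj q * s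
          + cnj s * q + (\<Sum>i\<in>X. \<Sum>j\<in>X. cnj (v i) * \<rho> i j * v j)"
      proof -
        have "(\<Sum>j\<in>X. cnj q * \<rho> x j * ?v j) = cnj q * s"
          unfolding s_def sum_distrib_left using insert.hyps(2) by (intro sum.cong) auto
        moreover have "(\<Sum>i\<in>X. cnj (?v i) * \<rho> i x * q) = cnj s * q"
          unfolding s'[symmetric] sum_distrib_right using insert.hyps(2) by (intro sum.cong) auto
        moreover have "(\<Sum>i\<in>X. \<Sum>j\<in>X. cnj (?v i) * \<rho> i j * ?v j)
            = (\<Sum>i\<in>X. \<Sum>j\<in>X. cnj (v i) * \<rho> i j * v j)"
          using insert.hyps(2) by (intro sum.cong) auto
        ultimately show ?thesis
          using insert.hyps by (simp add: sum.distrib d_def[symmetric])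
      qed
      also have "\<dots> = (\<Sum>i\<in>X. \<Sum>j\<in>X. cnj (v i) * \<rho> i j * v j) - cnj s * s / d"
        using d(1,4) by (simp add: q_def field_simps)
      also have "\<dots> = (\<Sum>i\<in>X. \<Sum>j\<in>X. cnj (v i) * \<sigma> i j * v j)"
        unfolding s'[symmetric] unfolding s_def sum_product sum_divide_distrib sum_subtractf[symmetric] \<sigma>_def
        by (intro sum.cong) (auto simp: field_simps)
      finally show "0 \<le> (\<Sum>i\<in>X. \<Sum>j\<in>X. cnj (v i) * \<sigma> i j * v j)" .
    qed
    then obtain n :: nat and u where u: "\<forall>i\<in>X. \<forall>j\<in>X. \<sigma> i j = (\<Sum>g<n. u g i * cnj (u g j))"
      using insert.IH by blast
    \<comment> \<open>The new vector, at index \<open>n\<close>, is column \<open>x\<close> divided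
      by the root of the pivot. The old ones are set to 0 at \<open>x\<close>, where row and column
      of the Schur complement vanish.\<close>
    let ?u = "\<lambda>(g::nat) i. if g < n then (if i = x then 0 else u g i) else \<rho> i x / of_real (sqrt (Re d))"
    have "\<rho> i j = (\<Sum>g<Suc n. ?u g i * cnj (?u g j))" if ij: "i \<in> insert x X" "j \<in> insert x X" for i j
    proof -
      have "of_real (sqrt (Re d)) * of_real (sqrt (Re d)) = d"
        using d(2,3) by (metis of_real_mult real_sqrt_mult_self abs_of_pos)
      then have "\<rho> i x / of_real (sqrt (Re d)) * cnj (\<rho> j x / of_real (sqrt (Re d))) = \<rho> i x * \<rho> x j / d"
        using herm[of j x] ij by simp
      moreover have "(\<Sum>g<n. ?u g i * cnj (?u g j)) = \<sigma> i j"
        using u ij d(1) insert.hyps(2) by (cases "i = x"; cases "j = x") (auto simp: \<sigma>_def d_def)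
      ultimately show ?thesis
        by (simp add: \<sigma>_def)
    qed
    then show ?thesis by (intro exI[of _ "Suc n"] exI[of _ ?u]) blast
  qed
qed

section \<open>Unitary freedom of purifications\<close>

text \<open>\<open>P = N M\<close> is the orthogonal projection onto the row space of \<open>M\<close>; it grows by one rank-one term
  whenever a new row has a component \<open>u\<close> orthogonal to the previous rows.\<close>

lemma row_space_projection:
  fixes M :: "'r \<Rightarrow> 'e \<Rightarrow> complex"
  assumes "finite R" "finite E"
  shows "\<exists>N P. (\<forall>k\<in>E. \<forall>k'\<in>E. P k k' = (\<Sum>r\<in>R. N k r * M r k')) \<and>
    (\<forall>k\<in>E. \<forall>k'\<in>E. P k' k = cnj (P k k')) \<and>
    (\<forall>r\<in>R. \<forall>k\<in>E. (\<Sum>k'\<in>E. M r k' * P k' k) = M r k)"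
  using assms(1)
proof (induction R rule: finite_induct)
  case empty
  show ?case by (rule exI, rule exI[of _ "\<lambda>_ _. 0"]) simp
next
  case (insert x R)
  then obtain N P where *: "(\<forall>k\<in>E. \<forall>k'\<in>E. P k k' = (\<Sum>r\<in>R. N k r * M r k')) \<and>
    (\<forall>k\<in>E. \<forall>k'\<in>E. P k' k = cnj (P k k')) \<and>
    (\<forall>r\<in>R. \<forall>k\<in>E. (\<Sum>k'\<in>E. M r k' * P k' k) = M r k)"
    by (elim exE)
  have NP: "P k k' = (\<Sum>r\<in>R. N k r * M r k')" if "k \<in> E" "k' \<in> E" for k k'
    using * that by blast
  have herm: "P k' k = cnj (P k k')" if "k \<in> E" "k' \<in> E" for k k'
    using * that by blast
  have MP: "(\<Sum>k'\<in>E. M r k' * P k' k) = M r k" if "r \<in> R" "k \<in> E" for r k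
    using * that by blast
  define u where "u = (\<lambda>k. M x k - (\<Sum>k'\<in>E. M x k' * P k' k))"
  have PP: "(\<Sum>k'\<in>E. P k k' * P k' k'') = P k k''" if "k \<in> E" "k'' \<in> E" for k k''
  proof -
    have "(\<Sum>k'\<in>E. P k k' * P k' k'') = (\<Sum>k'\<in>E. \<Sum>r\<in>R. N k r * (M r k' * P k' k''))"
      by (intro sum.cong) (auto simp: NP[OF that(1)] sum_distrib_right mult.assoc)
    also have "\<dots> = (\<Sum>r\<in>R. N k r * M r k'')"
      by (subst sum.swap) (simp add: sum_distrib_left[symmetric] MP that)
    finally show ?thesis by (simp add: NP that)
  qed
  have uP: "(\<Sum>k'\<in>E. u k' * P k' k) = 0" if "k \<in> E" for k
  proof -
    have "(\<Sum>k'\<in>E. (\<Sum>j\<in>E. M x j * P j k') * P k' k) = (\<Sum>j\<in>E. M x j * (\<Sum>k'\<in>E. P j k' * P k' k))"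
      unfolding sum_distrib_left sum_distrib_right by (subst sum.swap) (simp add: mult.assoc)
    also have "\<dots> = (\<Sum>j\<in>E. M x j * P j k)"
      using that by (simp add: PP)
    finally show ?thesis
      by (simp add: u_def left_diff_distrib sum_subtractf)
  qed
  have Pu: "(\<Sum>k'\<in>E. P k k' * cnj (u k')) = 0" if "k \<in> E" for k
  proof -
    have "(\<Sum>k'\<in>E. P k k' * cnj (u k')) = cnj (\<Sum>k'\<in>E. u k' * P k' k)"
      unfolding cnj_sum by (intro sum.cong) (auto simp: herm[of k] that)
    then show ?thesis by (simp add: uP that)
  qed
  have absorb: "(\<Sum>k\<in>E. (\<Sum>k'\<in>E. c k' * P k' k) * cnj (u k)) = 0" for c
  proof -
    have "(\<Sum>k\<in>E. (\<Sum>k'\<in>E. c k' * P k' k) * cnj (u k)) = (\<Sum>k'\<in>E. c k' * (\<Sum>k\<in>E. P k' k * cnj (u k)))"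
      unfolding sum_distrib_left sum_distrib_right by (subst sum.swap) (simp add: mult.assoc)
    then show ?thesis by (simp add: Pu)
  qed
  show ?case
  proof (cases "\<forall>k\<in>E. u k = 0")
    case True
    let ?N = "\<lambda>k r. if r = x then 0 else N k r"
    have a: "P k k' = (\<Sum>r\<in>insert x R. (if r = x then 0 else N k r) * M r k')" if "k \<in> E" "k' \<in> E" for k k'
      using insert.hyps by (simp add: NP that) (intro sum.cong, auto)
    have b: "(\<Sum>k'\<in>E. M r k' * P k' k) = M r k" if "r \<in> insert x R" "k \<in> E" for r k
    proof (cases "r = x")
      case True
      have "u k = 0" using \<open>\<forall>k\<in>E. u k = 0\<close> that(2) by blast
      with True show ?thesis by (simp only: u_def right_minus_eq)
    qed (use that MP in auto)
    show ?thesis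
      by (rule exI[of _ ?N], rule exI[of _ P]) (intro conjI ballI a b herm; assumption)
  next
    case False
    define d where "d = (\<Sum>k\<in>E. u k * cnj (u k))"
    have d_real: "d = of_real (\<Sum>k\<in>E. (cmod (u k))\<^sup>2)"
      unfolding d_def of_real_sum complex_norm_square by simp
    have d: "d \<noteq> 0" "cnj d = d"
      using False assms(2) by (auto simp: d_real sum_nonneg_eq_0_iff simp del: of_real_sum)
    have Mu: "(\<Sum>k\<in>E. M r k * cnj (u k)) = 0" if "r \<in> R" for r
      using absorb[of "M r"] that by (simp add: MP)
    have "(\<Sum>k\<in>E. M x k * cnj (u k)) = (\<Sum>k\<in>E. (u k + (\<Sum>k'\<in>E. M x k' * P k' k)) * cnj (u k))"
      by (simp add: u_def)
    then have xu: "(\<Sum>k\<in>E. M x k * cnj (u k)) = d"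
      by (simp only: distrib_right sum.distrib absorb d_def add_0_right)
    let ?P = "\<lambda>k k'. P k k' + cnj (u k) * u k' / d"
    \<comment> \<open>\<open>u\<close> is row \<open>x\<close> minus its projection, and the
      projection combines the old rows with coefficients
      \<open>\<Sum>j\<in>E. M x j * N j r\<close>. So the new rank-one term is again a combination
      of rows, and \<open>?N\<close> records its coefficients.\<close>
    let ?N = "\<lambda>k r. if r = x then cnj (u k) / d else N k r - cnj (u k) / d * (\<Sum>j\<in>E. M x j * N j r)"
    have a: "?P k k' = (\<Sum>r\<in>insert x R. ?N k r * M r k')" if "k \<in> E" "k' \<in> E" for k k'
    proof -
      have "(\<Sum>r\<in>insert x R. ?N k r * M r k') = cnj (u k) / d * M x k' +
          (\<Sum>r\<in>R. (N k r - cnj (u k) / d * (\<Sum>j\<in>E. M x j * N j r)) * M r k')"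
        using insert.hyps by simp (intro sum.cong, auto)
      also have "(\<Sum>r\<in>R. (N k r - cnj (u k) / d * (\<Sum>j\<in>E. M x j * N j r)) * M r k')
          = P k k' - cnj (u k) / d * (\<Sum>r\<in>R. (\<Sum>j\<in>E. M x j * N j r) * M r k')"
        unfolding left_diff_distrib sum_subtractf mult.assoc[of "cnj (u k) / d"] sum_distrib_left[symmetric]
          by (simp only: NP[OF that])
      also have "(\<Sum>r\<in>R. (\<Sum>j\<in>E. M x j * N j r) * M r k') = (\<Sum>j\<in>E. M x j * P j k')"
        unfolding sum_distrib_right
        by (subst sum.swap) (intro sum.cong, auto simp: NP that sum_distrib_left mult.assoc)
      also have "cnj (u k) / d * M x k' + (P k k' - cnj (u k) / d * (\<Sum>j\<in>E. M x j * P j k'))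
          = P k k' + cnj (u k) * (M x k' - (\<Sum>j\<in>E. M x j * P j k')) / d"
        using d(1) by (simp add: field_simps)
      finally show ?thesis by (simp only: u_def)
    qed
    have b: "?P k' k = cnj (?P k k')" if "k \<in> E" "k' \<in> E" for k k'
      using d(2) by (simp add: herm[OF that] mult.commute)
    have c: "(\<Sum>k'\<in>E. M r k' * ?P k' k) = M r k" if "r \<in> insert x R" "k \<in> E" for r k
    proof -
      have "(\<Sum>k'\<in>E. M r k' * ?P k' k)
          = (\<Sum>k'\<in>E. M r k' * P k' k) + (\<Sum>k'\<in>E. M r k' * cnj (u k')) * (u k / d)"
        unfolding distrib_left sum.distrib sum_distrib_right by (simp add: mult.assoc)
      also have "\<dots> = M r k"
      proof (cases "r = x")
        case True
        then have "(\<Sum>k'\<in>E. M r k' * P k' k) + (\<Sum>k'\<in>E. M r k' * cnj (u k')) * (u k / d)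
            = (\<Sum>k'\<in>E. M x k' * P k' k) + u k"
          using d(1) by (simp add: xu)
        then show ?thesis
          by (simp add: u_def True)
      next
        case False
        then show ?thesis using that by (simp add: Mu MP)
      qed
      finally show ?thesis .
    qed
    show ?thesis
      by (rule exI[of _ ?N], rule exI[of _ ?P]) (intro conjI ballI a b c; assumption)
  qed
qed

text \<open>This is what makes the assignment of \<open>\<psi> r\<close> to \<open>\<phi> r\<close>
  a well-defined isometry on the span: inner products of all combinations agree, so in particular a
  combination that vanishes on one side vanishes on the other.\<close>

lemma gram_combination:
  fixes \<phi> :: "'r \<Rightarrow> 'f \<Rightarrow> complex" and \<psi> :: "'r \<Rightarrow> 'g \<Rightarrow> complex"
  assumes "\<And>r r'. r \<in> R \<Longrightarrow> r' \<in> R \<Longrightarrow>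
    (\<Sum>l\<in>F. \<phi> r l * cnj (\<phi> r' l)) = (\<Sum>g\<in>G. \<psi> r g * cnj (\<psi> r' g))"
  shows "(\<Sum>l\<in>F. (\<Sum>r\<in>R. \<alpha> r * \<phi> r l) * cnj (\<Sum>r\<in>R. \<beta> r * \<phi> r l))
    = (\<Sum>g\<in>G. (\<Sum>r\<in>R. \<alpha> r * \<psi> r g) * cnj (\<Sum>r\<in>R. \<beta> r * \<psi> r g))"
proof -
  have expand: "(\<Sum>l\<in>F. (\<Sum>r\<in>R. \<alpha> r * \<chi> r l) * cnj (\<Sum>r\<in>R. \<beta> r * \<chi> r l))
      = (\<Sum>r\<in>R. \<Sum>r'\<in>R. \<alpha> r * cnj (\<beta> r') * (\<Sum>l\<in>F. \<chi> r l * cnj (\<chi> r' l)))"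
    for F and \<chi> :: "'r \<Rightarrow> 'h \<Rightarrow> complex"
  proof -
    have "(\<Sum>l\<in>F. (\<Sum>r\<in>R. \<alpha> r * \<chi> r l) * cnj (\<Sum>r\<in>R. \<beta> r * \<chi> r l))
        = (\<Sum>l\<in>F. \<Sum>r\<in>R. \<Sum>r'\<in>R. \<alpha> r * cnj (\<beta> r') * (\<chi> r l * cnj (\<chi> r' l)))"
      unfolding cnj_sum sum_product by (simp add: mult_ac)
    also have "\<dots> = (\<Sum>r\<in>R. \<Sum>r'\<in>R. \<Sum>l\<in>F. \<alpha> r * cnj (\<beta> r') * (\<chi> r l * cnj (\<chi> r' l)))"
      by (subst sum.swap, intro sum.cong refl, rule sum.swap)
    finally show ?thesis by (simp add: sum_distrib_left)
  qed
  show ?thesis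
    unfolding expand using assms by simp
qed

lemma sum_lessThan_add:
  fixes h :: "nat \<Rightarrow> 'a::comm_monoid_add"
  shows "(\<Sum>x<n + m. h x) = (\<Sum>x<n. h x) + (\<Sum>x<m. h (n + x))"
  by (induction m) (simp_all add: add.assoc)

text \<open>The extra rows \<open>n..<n + f\<close> at \<open>y0\<close> hold \<open>1 - P\<close>, which completes the partial isometry with
  support projection \<open>P\<close> to an isometry.\<close>

lemma purification_isometry:
  fixes \<phi> :: "'r \<Rightarrow> nat \<Rightarrow> complex" and \<psi> :: "'r \<Rightarrow> nat \<times> 'y \<Rightarrow> complex"
  assumes fin: "finite R" "finite Y" and y0: "y0 \<in> Y"
    and gram: "\<And>r r'. r \<in> R \<Longrightarrow> r' \<in> R \<Longrightarrow>
      (\<Sum>l<f. \<phi> r l * cnj (\<phi> r' l)) = (\<Sum>g\<in>{..<n} \<times> Y. \<psi> r g * cnj (\<psi> r' g))"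
    and supp: "\<And>r g. r \<in> R \<Longrightarrow> g \<notin> {..<n} \<times> Y \<Longrightarrow> \<psi> r g = 0"
  shows "\<exists>W\<in>isometries {..<f} ({..<n + f} \<times> Y). \<forall>r\<in>R. \<forall>g. \<psi> r g = (\<Sum>l<f. W g l * \<phi> r l)"
proof -
  let ?G = "{..<n} \<times> Y"
  obtain N P where *: "(\<forall>l\<in>{..<f}. \<forall>l'\<in>{..<f}. P l l' = (\<Sum>r\<in>R. N l r * \<phi> r l')) \<and>
    (\<forall>l\<in>{..<f}. \<forall>l'\<in>{..<f}. P l' l = cnj (P l l')) \<and>
    (\<forall>r\<in>R. \<forall>l\<in>{..<f}. (\<Sum>l'<f. \<phi> r l' * P l' l) = \<phi> r l)"
    using row_space_projection[where M = \<phi>, OF fin(1) finite_lessThan[of f]] by (elim exE)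
  have NP: "P l l' = (\<Sum>r\<in>R. N l r * \<phi> r l')" if "l < f" "l' < f" for l l'
    using * that by blast
  have herm: "P l' l = cnj (P l l')" if "l < f" "l' < f" for l l'
    using * that by blast
  have MP: "(\<Sum>l'<f. \<phi> r l' * P l' l) = \<phi> r l" if "r \<in> R" "l < f" for r l
    using * that by blast
  \<comment> \<open>The rows of \<open>N\<close> express \<open>P\<close> through the vectors
    \<open>\<phi> r\<close>; the same coefficients applied to \<open>\<psi> r\<close> give the
    partial isometry that carries \<open>\<phi> r\<close> to \<open>\<psi> r\<close>.\<close>
  define V where "V = (\<lambda>g l. \<Sum>r\<in>R. N l r * \<psi> r g)"
  \<comment> \<open>\<open>Q\<close> is \<open>1 - P\<close> transposed: \<open>W\<close> acts as
    \<open>\<Sum>l<f. W g l * \<phi> r l\<close>, which puts \<open>\<phi> r\<close> to the left of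
    \<open>P\<close>. The extra rows therefore annihilate every \<open>\<phi> r\<close>.\<close>
  define Q where "Q = (\<lambda>l' l. (if l = l' then 1 else 0) - P l l')"
  define W where "W = (\<lambda>(x, y) l. if l < f \<and> y \<in> Y then
      (if x < n then V (x, y) l else if x < n + f \<and> y = y0 then Q (x - n) l else 0) else 0)"
  have PP: "(\<Sum>l''<f. P l l'' * P l'' l') = P l l'" if "l < f" "l' < f" for l l'
  proof -
    have "(\<Sum>l''<f. P l l'' * P l'' l') = (\<Sum>l''<f. \<Sum>r\<in>R. N l r * (\<phi> r l'' * P l'' l'))"
      by (intro sum.cong) (auto simp: NP[OF that(1)] sum_distrib_right mult.assoc)
    also have "\<dots> = (\<Sum>r\<in>R. N l r * \<phi> r l')"
      by (subst sum.swap) (simp add: sum_distrib_left[symmetric] MP that)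
    finally show ?thesis by (simp add: NP that)
  qed
  have gram_comb: "(\<Sum>l<f. (\<Sum>r\<in>R. \<alpha> r * \<phi> r l) * cnj (\<Sum>r\<in>R. \<beta> r * \<phi> r l))
    = (\<Sum>g\<in>?G. (\<Sum>r\<in>R. \<alpha> r * \<psi> r g) * cnj (\<Sum>r\<in>R. \<beta> r * \<psi> r g))" for \<alpha> \<beta>
    by (rule gram_combination) (rule gram)
  have VV: "(\<Sum>g\<in>?G. V g l * cnj (V g l')) = P l l'" if "l < f" "l' < f" for l l'
  proof -
    have "(\<Sum>g\<in>?G. V g l * cnj (V g l')) = (\<Sum>l''<f. P l l'' * cnj (P l' l''))"
      unfolding V_def gram_comb[symmetric] by (simp add: NP that)
    also have "\<dots> = (\<Sum>l''<f. P l l'' * P l'' l')"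
      by (intro sum.cong) (auto simp: herm[OF that(2)])
    finally show ?thesis by (simp add: PP that)
  qed
  have V: "(\<Sum>l<f. V g l * \<phi> r l) = \<psi> r g" if r: "r \<in> R" and g: "g \<in> ?G" for r g
  proof -
    \<comment> \<open>These coefficients represent \<open>\<phi> r\<close> minus its image under
      \<open>P\<close>, which is zero. The same combination of the \<open>\<psi>\<close> then has
      norm zero, and its vanishing is exactly the claim.\<close>
    define \<alpha> where "\<alpha> = (\<lambda>r'. (if r' = r then 1 else 0) - (\<Sum>l<f. \<phi> r l * N l r'))"
    have \<alpha>: "(\<Sum>r'\<in>R. \<alpha> r' * c r') = c r - (\<Sum>l<f. \<phi> r l * (\<Sum>r'\<in>R. N l r' * c r'))" for c
    proof -
      have "(\<Sum>r'\<in>R. (\<Sum>l<f. \<phi> r l * N l r') * c r') = (\<Sum>l<f. \<phi> r l * (\<Sum>r'\<in>R. N l r' * c r'))"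
        unfolding sum_distrib_left sum_distrib_right by (subst sum.swap) (simp add: mult.assoc)
      then show ?thesis
        using r fin(1) by (simp add: \<alpha>_def left_diff_distrib sum_subtractf if_distrib[of "\<lambda>z. z * _"] sum.delta cong: if_cong)
    qed
    have "(\<Sum>r'\<in>R. \<alpha> r' * \<phi> r' l) = 0" if "l < f" for l
    proof -
      have "(\<Sum>l'<f. \<phi> r l' * (\<Sum>r'\<in>R. N l' r' * \<phi> r' l)) = (\<Sum>l'<f. \<phi> r l' * P l' l)"
        using that by (simp add: NP)
      then show ?thesis unfolding \<alpha> by (simp add: MP r that)
    qed
    then have "(\<Sum>g\<in>?G. (\<Sum>r'\<in>R. \<alpha> r' * \<psi> r' g) * cnj (\<Sum>r'\<in>R. \<alpha> r' * \<psi> r' g)) = 0"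
      unfolding gram_comb[symmetric] by simp
    then have "of_real (\<Sum>g\<in>?G. (cmod (\<Sum>r'\<in>R. \<alpha> r' * \<psi> r' g))\<^sup>2) = (0::complex)"
      unfolding of_real_sum complex_norm_square by simp
    then have "(\<Sum>r'\<in>R. \<alpha> r' * \<psi> r' g) = 0"
      using g fin(2) by (cases g) (simp add: sum_nonneg_eq_0_iff del: of_real_sum)
    then show ?thesis
      unfolding \<alpha> by (simp add: V_def mult.commute)
  qed
  have split: "(\<Sum>g\<in>{..<n + f} \<times> Y. h g) = (\<Sum>g\<in>?G. h g) + (\<Sum>l''<f. \<Sum>y\<in>Y. h (n + l'', y))" for h :: "nat \<times> 'y \<Rightarrow> complex"
  proof -
    have "(\<Sum>x<n + f. \<Sum>y\<in>Y. h (x, y)) = (\<Sum>x<n. \<Sum>y\<in>Y. h (x, y)) + (\<Sum>l''<f. \<Sum>y\<in>Y. h (n + l'', y))"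
      by (rule sum_lessThan_add)
    then show ?thesis by (simp add: sum.cartesian_product)
  qed
  have QQ: "(\<Sum>l''<f. cnj (Q l'' l) * Q l'' l') = (if l = l' then 1 else 0) - P l' l" if "l < f" "l' < f" for l l'
  proof -
    have "(\<Sum>l''<f. cnj (Q l'' l) * Q l'' l')
        = (\<Sum>l''<f. ((if l = l'' then 1 else 0) - P l'' l) * ((if l' = l'' then 1 else 0) - P l' l''))"
      by (intro sum.cong) (auto simp: Q_def herm[OF that(1)])
    also have "\<dots> = (\<Sum>l''<f. if l = l'' then (if l' = l then 1 else 0) - P l' l'' else 0)
        - (\<Sum>l''<f. if l' = l'' then P l'' l else 0) + (\<Sum>l''<f. P l' l'' * P l'' l)"
      unfolding sum_subtractf[symmetric] sum.distrib[symmetric]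
      by (intro sum.cong) (auto simp: algebra_simps)
    finally show ?thesis
      using that by (simp add: PP sum.delta)
  qed
  have "W \<in> isometries {..<f} ({..<n + f} \<times> Y)"
  proof -
    have "(\<Sum>t\<in>{..<n + f} \<times> Y. cnj (W t l) * W t l') = (if l = l' then 1 else 0)"
      if "l < f" "l' < f" for l l'
    proof -
      have "(\<Sum>g\<in>?G. cnj (W g l) * W g l') = (\<Sum>g\<in>?G. V g l' * cnj (V g l))"
        using that by (intro sum.cong) (auto simp: W_def)
      moreover have "(\<Sum>y\<in>Y. cnj (W (n + l'', y) l) * W (n + l'', y) l') = cnj (Q l'' l) * Q l'' l'"
        if "l'' < f" for l''
      proof -
        have "(\<Sum>y\<in>Y. cnj (W (n + l'', y) l) * W (n + l'', y) l')
            = (\<Sum>y\<in>Y. if y = y0 then cnj (Q l'' l) * Q l'' l' else 0)"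
          using that \<open>l < f\<close> \<open>l' < f\<close> by (intro sum.cong) (auto simp: W_def)
        then show ?thesis using y0 fin(2) by (simp add: sum.delta)
      qed
      ultimately show ?thesis
        unfolding split using that by (simp add: VV QQ)
    qed
    then show ?thesis
      by (auto simp: isometries_def W_def split: if_splits)
  qed
  moreover have "\<psi> r g = (\<Sum>l<f. W g l * \<phi> r l)" if r: "r \<in> R" for r g
  proof -
    obtain x y where xy: "g = (x, y)" by force
    consider "g \<in> ?G" | "g \<notin> ?G" "y \<in> Y" "x < n + f" "y = y0" | "g \<notin> ?G" "\<not> (y \<in> Y \<and> x < n + f \<and> y = y0)"
      by blast
    then show ?thesis
    proof cases
      case 1
      then show ?thesis
        using V[OF r 1] by (simp add: W_def xy)
    next
      case 2
      then have "n \<le> x" by (auto simp: xy)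
      then have "x - n < f" using 2(3) by linarith
      have "(\<Sum>l<f. W g l * \<phi> r l) = (\<Sum>l<f. if l = x - n then \<phi> r l else 0) - (\<Sum>l<f. \<phi> r l * P l (x - n))"
        unfolding sum_subtractf[symmetric] using 2 \<open>n \<le> x\<close>
        by (intro sum.cong) (auto simp: W_def xy Q_def algebra_simps)
      also have "\<dots> = 0"
        using \<open>x - n < f\<close> r by (simp add: MP sum.delta)
      finally show ?thesis using supp[OF r 2(1)] by simp
    next
      case 3
      then have "W g l = 0" for l
        by (auto simp: W_def xy)
      then show ?thesis using supp[OF r 3(1)] by simp
    qed
  qed
  ultimately show ?thesis by blast
qed

section \<open>Embedding into larger spaces\<close>

text \<open>Two enumerations of \<open>X\<close> differ by a permutation, so the matrices are
  similar via permutation matrices. The freedom matters because the enumeration that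
  \<open>matrix_of\<close> takes of a larger set need not extend the one it takes of a
  subset.\<close>

lemma char_poly_reindex:
  fixes \<rho> :: "'i op"
  assumes g: "bij_betw g {..<n} X" and h: "bij_betw h {..<n} X"
  shows "char_poly (mat n n (\<lambda>(i, j). \<rho> (g i) (g j))) = char_poly (mat n n (\<lambda>(i, j). \<rho> (h i) (h j)))"
proof -
  have fin: "finite X"
    using bij_betw_finite[OF g] by simp
  define P :: "complex mat" where "P = mat n n (\<lambda>(i, j). if g i = h j then 1 else 0)"
  define Q :: "complex mat" where "Q = mat n n (\<lambda>(i, j). if h i = g j then 1 else 0)"
  let ?G = "mat n n (\<lambda>(i, j). \<rho> (g i) (g j))" and ?H = "mat n n (\<lambda>(i, j). \<rho> (h i) (h j))"
  have mem: "g i \<in> X" "h i \<in> X" if "i < n" for i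
    using that g h by (auto simp: bij_betw_def)
  have inj: "g i = g j \<longleftrightarrow> i = j" "h i = h j \<longleftrightarrow> i = j" if "i < n" "j < n" for i j
    using that g h by (auto simp: bij_betw_def inj_on_def)
  have sum_g: "(\<Sum>k = 0..<n. c (g k)) = (\<Sum>x\<in>X. c x)" for c :: "'i \<Rightarrow> complex"
    using sum.reindex_bij_betw[OF g, of c] by (simp add: atLeast0LessThan)
  have sum_h: "(\<Sum>k = 0..<n. c (h k)) = (\<Sum>x\<in>X. c x)" for c :: "'i \<Rightarrow> complex"
    using sum.reindex_bij_betw[OF h, of c] by (simp add: atLeast0LessThan)
  have delta: "(\<Sum>x\<in>X. (if a = x then 1 else 0) * c x) = c a"
      "(\<Sum>x\<in>X. c x * (if x = a then 1 else 0)) = c a" if "a \<in> X" for a and c :: "'i \<Rightarrow> complex"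
    using that fin by (simp_all add: if_distrib[of "\<lambda>z. z * _"] if_distrib[of "\<lambda>z. _ * z"] cong: if_cong)
  have "P * Q = 1\<^sub>m n"
    by (rule eq_matI) (auto simp: P_def Q_def scalar_prod_def sum_h[of "\<lambda>x. (if g _ = x then 1 else 0) * (if x = g _ then 1 else 0)"] inj mem delta)
  moreover have "Q * P = 1\<^sub>m n"
    by (rule eq_matI) (auto simp: P_def Q_def scalar_prod_def sum_g[of "\<lambda>x. (if h _ = x then 1 else 0) * (if x = h _ then 1 else 0)"] inj mem delta)
  moreover have "?G = P * ?H * Q"
  proof (rule eq_matI)
    fix i j assume "i < dim_row (P * ?H * Q)" "j < dim_col (P * ?H * Q)"
    then have ij: "i < n" "j < n" by (auto simp: P_def Q_def)
    have PH: "P * ?H = mat n n (\<lambda>(i, j). \<rho> (g i) (h j))"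
      by (rule eq_matI) (auto simp: P_def scalar_prod_def sum_h[of "\<lambda>x. (if g _ = x then 1 else 0) * \<rho> x (h _)"]
          mem delta)
    show "?G $$ (i, j) = (P * ?H * Q) $$ (i, j)"
      unfolding PH using ij
      by (auto simp: Q_def scalar_prod_def sum_h[of "\<lambda>x. \<rho> (g i) x * (if x = g j then 1 else 0)"]
          mem delta)
  qed (auto simp: P_def Q_def)
  ultimately have "similar_mat_wit ?G ?H P Q"
    by (rule similar_mat_witI) (simp_all add: P_def Q_def)
  then have "similar_mat ?G ?H"
    unfolding similar_mat_def by blast
  then show ?thesis
    by (rule char_poly_similar)
qed

text \<open>The characteristic matrix is again block diagonal, and the zero corner contributes
  \<open>m\<close> roots at 0.\<close>

lemma char_poly_zero_block:
  fixes A :: "complex mat"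
  assumes "A \<in> carrier_mat n n"
  shows "char_poly (four_block_mat A (0\<^sub>m n m) (0\<^sub>m m n) (0\<^sub>m m m)) = char_poly A * [:0, 1:] ^ m"
proof -
  have "char_poly_matrix (four_block_mat A (0\<^sub>m n m) (0\<^sub>m m n) (0\<^sub>m m m))
      = four_block_mat (char_poly_matrix A) (0\<^sub>m n m) (0\<^sub>m m n) (char_poly_matrix (0\<^sub>m m m))"
    using assms by (intro eq_matI) (auto simp: char_poly_matrix_def)
  moreover have "char_poly (0\<^sub>m m m :: complex mat) = [:0, 1:] ^ m"
  proof -
    have "char_poly (0\<^sub>m m m :: complex mat) = (\<Prod>a\<leftarrow>diag_mat (0\<^sub>m m m). [:- a, 1:])"
      by (rule char_poly_upper_triangular[of _ m]) auto
    also have "\<dots> = (\<Prod>a\<leftarrow>replicate m (0::complex). [:- a, 1:])"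
      by (intro arg_cong[of _ _ prod_list] arg_cong2[of _ _ _ _ map] refl nth_equalityI) (auto simp: diag_mat_def)
    finally show ?thesis
      by (simp add: map_replicate_const)
  qed
  ultimately show ?thesis
    unfolding char_poly_def
    using det_four_block_mat_lower_left_zero[of "char_poly_matrix A" n "0\<^sub>m n m" m "0\<^sub>m m n" "char_poly_matrix (0\<^sub>m m m)"] assms
    by simp
qed

text \<open>Embedding only adds zero eigenvalues, and each contributes a summand with factor
  0.\<close>

lemma entropy_superset:
  assumes fin: "finite Y" and sub: "X \<subseteq> Y" and op: "\<rho> \<in> operators X"
  shows "entropy Y \<rho> = entropy X \<rho>"
proof -
  have finX: "finite X" and finD: "finite (Y - X)"
    using fin sub by (auto intro: finite_subset)
  define n where "n = card X"
  define m where "m = card (Y - X)"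
  have card: "card Y = n + m"
    using card_Diff_subset[OF finX sub] card_mono[OF fin sub] by (simp add: n_def m_def)
  \<comment> \<open>Listing \<open>X\<close> first, in the order used by \<open>matrix_of X\<close>,
    makes the leading block literally \<open>matrix_of X \<rho>\<close>.\<close>
  define h where "h = (\<lambda>i. if i < n then from_nat_into X i else from_nat_into (Y - X) (i - n))"
  have bX: "bij_betw (from_nat_into X) {..<n} X"
    unfolding n_def by (rule bij_betw_from_nat_into_finite[OF finX])
  have bD: "bij_betw (from_nat_into (Y - X)) {..<m} (Y - X)"
    unfolding m_def by (rule bij_betw_from_nat_into_finite[OF finD])
  have hX: "bij_betw h {..<n} X"
    using bX by (rule iffD1[OF bij_betw_cong, rotated]) (simp add: h_def)
  have "bij_betw (\<lambda>i. i - n) {n..<n + m} {..<m}"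
    by (rule bij_betwI[where g = "\<lambda>i. i + n"]) auto
  from bij_betw_trans[OF this bD] have hD: "bij_betw h {n..<n + m} (Y - X)"
    by (rule iffD1[OF bij_betw_cong, rotated]) (simp add: h_def)
  have "bij_betw h ({..<n} \<union> {n..<n + m}) (X \<union> (Y - X))"
    by (rule bij_betw_combine[OF hX hD]) auto
  moreover have "{..<n} \<union> {n..<n + m} = {..<n + m}" "X \<union> (Y - X) = Y"
    using sub by auto
  ultimately have hY: "bij_betw h {..<n + m} Y"
    by simp
  have zero: "\<rho> i j = 0" if "i \<notin> X \<or> j \<notin> X" for i j
    using op that by (auto simp: operators_def)
  have hmem: "h i \<in> X \<longleftrightarrow> i < n" if "i < n + m" for i
    using that bij_betwE[OF hX] bij_betwE[OF hD] by (cases "i < n") auto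
  have out: "from_nat_into (Y - X) (i - n) \<notin> X" if "i < n + m" "\<not> i < n" for i
    using hmem[of i] that by (simp add: h_def)
  have "char_poly (matrix_of Y \<rho>) = char_poly (mat (n + m) (n + m) (\<lambda>(i, j). \<rho> (h i) (h j)))"
    unfolding matrix_of_def card
    by (rule char_poly_reindex[OF _ hY]) (use bij_betw_from_nat_into_finite[OF fin] card in simp)
  also have "mat (n + m) (n + m) (\<lambda>(i, j). \<rho> (h i) (h j))
      = four_block_mat (matrix_of X \<rho>) (0\<^sub>m n m) (0\<^sub>m m n) (0\<^sub>m m m)"
    by (rule eq_matI) (auto simp: matrix_of_def n_def[symmetric] h_def zero out)
  also have "char_poly \<dots> = char_poly (matrix_of X \<rho>) * [:0, 1:] ^ m"
    by (rule char_poly_zero_block) (simp add: matrix_of_def n_def)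
  finally have cp: "char_poly (matrix_of Y \<rho>) = char_poly (matrix_of X \<rho>) * [:0, 1:] ^ m" .
  \<comment> \<open>Root multisets add under products of nonzero polynomials; a characteristic
    polynomial is monic.\<close>
  have "char_poly (matrix_of X \<rho>) \<noteq> 0"
    using degree_monic_char_poly[of "matrix_of X \<rho>" n] by (auto simp: matrix_of_def n_def)
  then have "proots (char_poly (matrix_of Y \<rho>)) = proots (char_poly (matrix_of X \<rho>)) + replicate_mset m 0"
    unfolding cp by (subst proots_mult) (auto simp: proots_power repeat_mset_replicate_mset)
  then show ?thesis
    by (simp add: entropy_def)
qed

lemma operators_mono: "X \<subseteq> Y \<Longrightarrow> operators X \<subseteq> operators Y"
  by (auto simp: operators_def)

lemma density_ops_mono:
  assumes "finite Y" "X \<subseteq> Y"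
  shows "density_ops X \<subseteq> density_ops Y"
proof
  fix \<rho> assume \<rho>: "\<rho> \<in> density_ops X"
  then have zero: "\<rho> i i = 0" if "i \<notin> X" for i
    using that by (auto simp: density_ops_def positive_ops_def operators_def)
  have "op_trace Y \<rho> = op_trace X \<rho>"
    unfolding op_trace_def using assms zero by (intro sum.mono_neutral_right) auto
  then show "\<rho> \<in> density_ops Y"
    using \<rho> operators_mono[OF assms(2)] psd_superset[OF assms]
    by (auto simp: density_ops_def positive_ops_iff_psd)
qed

text \<open>Operators vanish off their index sets, so embedding leaves the function unchanged and
  the same convex decomposition can be kept.\<close>

lemma separable_states_mono:
  assumes "finite X'" "X \<subseteq> X'" "finite Y'" "Y \<subseteq> Y'"
  shows "separable_states X Y \<subseteq> separable_states X' Y'"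
  unfolding separable_states_def
  using density_ops_mono[OF assms(1,2)] density_ops_mono[OF assms(3,4)] by blast

text \<open>The partial traces over the larger sets gain only zero terms, so all four reduced
  operators are unchanged and \<open>entropy_superset\<close> applies. This permits replacing
  \<open>F\<^sub>A\<close> by a larger space.\<close>

lemma cmi_superset:
  assumes fin: "finite X'" "finite Y'" "finite Z" and sub: "X \<subseteq> X'" "Y \<subseteq> Y'"
    and op: "\<rho> \<in> operators (X \<times> Y \<times> Z)"
  shows "cmi X' Y' Z \<rho> = cmi X Y Z \<rho>"
proof -
  have supp: "i \<in> X \<times> Y \<times> Z \<and> j \<in> X \<times> Y \<times> Z" if "\<rho> i j \<noteq> 0" for i j
    using op that unfolding operators_def by blast
  have zero: "\<rho> (x, y, z) j = 0" if "x \<notin> X \<or> y \<notin> Y \<or> z \<notin> Z" for x y z j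
    using supp[of "(x, y, z)" j] that by auto
  have zero': "\<rho> j (x, y, z) = 0" if "x \<notin> X \<or> y \<notin> Y \<or> z \<notin> Z" for x y z j
    using supp[of j "(x, y, z)"] that by auto
  have XZ: "ptrace (\<lambda>(x, z) y. (x, y, z)) Y' \<rho> = ptrace (\<lambda>(x, z) y. (x, y, z)) Y \<rho>"
    unfolding ptrace_def using fin sub zero
    by (intro ext sum.mono_neutral_right) (auto split: prod.splits)
  have YZ: "ptrace (\<lambda>(y, z) x. (x, y, z)) X' \<rho> = ptrace (\<lambda>(y, z) x. (x, y, z)) X \<rho>"
    unfolding ptrace_def using fin sub zero
    by (intro ext sum.mono_neutral_right) (auto split: prod.splits)
  have Z: "ptrace (\<lambda>z (x, y). (x, y, z)) (X' \<times> Y') \<rho> = ptrace (\<lambda>z (x, y). (x, y, z)) (X \<times> Y) \<rho>"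
    unfolding ptrace_def using fin sub
    by (intro ext sum.mono_neutral_right) (auto split: prod.splits dest: supp)
  have "ptrace (\<lambda>(x, z) y. (x, y, z)) Y \<rho> \<in> operators (X \<times> Z)"
    using zero zero' by (fastforce simp: operators_def ptrace_def intro!: sum.neutral)
  moreover have "ptrace (\<lambda>(y, z) x. (x, y, z)) X \<rho> \<in> operators (Y \<times> Z)"
    using zero zero' by (fastforce simp: operators_def ptrace_def intro!: sum.neutral)
  ultimately show ?thesis
    unfolding cmi_def XZ YZ Z
    using entropy_superset[of "X' \<times> Z" "X \<times> Z"] entropy_superset[of "Y' \<times> Z" "Y \<times> Z"]
      entropy_superset[OF _ _ op, of "X' \<times> Y' \<times> Z"] fin sub
    by (simp add: Sigma_mono)
qed

section \<open>Positive and completely positive maps\<close>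

lemma operatorsI: "(\<And>i j. i \<notin> X \<or> j \<notin> X \<Longrightarrow> \<rho> i j = 0) \<Longrightarrow> \<rho> \<in> operators X"
  by (auto simp: operators_def)

lemma operators_zero: "\<rho> \<in> operators X \<Longrightarrow> i \<notin> X \<or> j \<notin> X \<Longrightarrow> \<rho> i j = 0"
  by (auto simp: operators_def)

lemma psd_reindex:
  assumes h: "bij_betw h X' X"
  shows "psd X' (relabel h \<rho>) \<longleftrightarrow> psd X \<rho>"
proof -
  have eq: "(\<Sum>i\<in>X. \<Sum>j\<in>X. cnj (v i) * \<rho> i j * v j)
      = (\<Sum>i\<in>X'. \<Sum>j\<in>X'. cnj (v (h i)) * relabel h \<rho> i j * v (h j))" for v
    unfolding relabel_def
    by (subst sum.reindex_bij_betw[OF h, symmetric], subst sum.reindex_bij_betw[OF h, symmetric]) simp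
  show ?thesis
  proof
    assume "psd X' (relabel h \<rho>)"
    from psdD[OF this] show "psd X \<rho>"
      unfolding psd_def eq by (intro allI)
  next
    assume \<rho>: "psd X \<rho>"
    show "psd X' (relabel h \<rho>)"
      unfolding psd_def
    proof
      fix v
      have "inv_into X' h (h i) = i" if "i \<in> X'" for i
        using bij_betw_inv_into_left[OF h that] .
      then show "0 \<le> (\<Sum>i\<in>X'. \<Sum>j\<in>X'. cnj (v i) * relabel h \<rho> i j * v j)"
        using psdD[OF \<rho>, of "\<lambda>i. v (inv_into X' h i)"] unfolding eq by simp
    qed
  qed
qed

lemma psd_cong:
  assumes "\<And>i j. i \<in> X \<Longrightarrow> j \<in> X \<Longrightarrow> \<rho> i j = \<sigma> i j"
  shows "psd X \<rho> \<longleftrightarrow> psd X \<sigma>"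
proof -
  have "(\<Sum>i\<in>X. \<Sum>j\<in>X. cnj (v i) * \<rho> i j * v j) = (\<Sum>i\<in>X. \<Sum>j\<in>X. cnj (v i) * \<sigma> i j * v j)" for v
    using assms by (intro sum.cong) auto
  then show ?thesis
    by (simp add: psd_def)
qed

lemma psd_proj: "psd X (proj \<psi>)"
  unfolding psd_def
proof
  fix v
  let ?s = "\<Sum>i\<in>X. cnj (v i) * \<psi> i"
  have "(\<Sum>i\<in>X. \<Sum>j\<in>X. cnj (v i) * proj \<psi> i j * v j) = ?s * cnj ?s"
    unfolding cnj_sum sum_product proj_def by (intro sum.cong) (auto simp: mult_ac)
  also have "\<dots> = of_real ((cmod ?s)\<^sup>2)"
    by (rule complex_norm_square[symmetric])
  finally show "0 \<le> (\<Sum>i\<in>X. \<Sum>j\<in>X. cnj (v i) * proj \<psi> i j * v j)"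
    by (simp add: less_eq_complex_def)
qed

lemma psd_sum:
  assumes "\<And>z. z \<in> Z \<Longrightarrow> psd X (\<rho> z)"
  shows "psd X (\<lambda>i j. \<Sum>z\<in>Z. \<rho> z i j)"
  unfolding psd_def
proof
  fix v
  have "(\<Sum>i\<in>X. \<Sum>j\<in>X. cnj (v i) * (\<Sum>z\<in>Z. \<rho> z i j) * v j)
      = (\<Sum>i\<in>X. \<Sum>j\<in>X. \<Sum>z\<in>Z. cnj (v i) * \<rho> z i j * v j)"
    by (simp add: sum_distrib_left sum_distrib_right)
  also have "\<dots> = (\<Sum>i\<in>X. \<Sum>z\<in>Z. \<Sum>j\<in>X. cnj (v i) * \<rho> z i j * v j)"
    by (intro sum.cong refl sum.swap)
  also have "\<dots> = (\<Sum>z\<in>Z. \<Sum>i\<in>X. \<Sum>j\<in>X. cnj (v i) * \<rho> z i j * v j)"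
    by (rule sum.swap)
  finally show "0 \<le> (\<Sum>i\<in>X. \<Sum>j\<in>X. cnj (v i) * (\<Sum>z\<in>Z. \<rho> z i j) * v j)"
    using assms by (simp add: sum_nonneg psdD)
qed

text \<open>The conjugation is moved onto the test vector: \<open>w\<close> is the adjoint of
  \<open>W\<close> applied to \<open>v\<close>. The kernel is arbitrary, so single Kraus operators
  are covered as well.\<close>

lemma psd_induced_map:
  assumes "psd X \<rho>"
  shows "psd Y (induced_map X W \<rho>)"
  unfolding psd_def
proof
  fix v
  define w where "w = (\<lambda>s. \<Sum>t\<in>Y. cnj (W t s) * v t)"
  have "(\<Sum>t\<in>Y. \<Sum>t'\<in>Y. cnj (v t) * induced_map X W \<rho> t t' * v t')
      = (\<Sum>t\<in>Y. \<Sum>t'\<in>Y. \<Sum>s\<in>X. \<Sum>s'\<in>X. cnj (v t) * W t s * \<rho> s s' * cnj (W t' s') * v t')"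
    by (simp add: induced_map_def sum_distrib_left sum_distrib_right mult.assoc)
  also have "\<dots> = (\<Sum>t\<in>Y. \<Sum>s\<in>X. \<Sum>t'\<in>Y. \<Sum>s'\<in>X. cnj (v t) * W t s * \<rho> s s' * cnj (W t' s') * v t')"
    by (intro sum.cong refl sum.swap)
  also have "\<dots> = (\<Sum>s\<in>X. \<Sum>t\<in>Y. \<Sum>t'\<in>Y. \<Sum>s'\<in>X. cnj (v t) * W t s * \<rho> s s' * cnj (W t' s') * v t')"
    by (rule sum.swap)
  also have "\<dots> = (\<Sum>s\<in>X. \<Sum>t\<in>Y. \<Sum>s'\<in>X. \<Sum>t'\<in>Y. cnj (v t) * W t s * \<rho> s s' * cnj (W t' s') * v t')"
    by (intro sum.cong refl sum.swap)
  also have "\<dots> = (\<Sum>s\<in>X. \<Sum>s'\<in>X. \<Sum>t\<in>Y. \<Sum>t'\<in>Y. cnj (v t) * W t s * \<rho> s s' * cnj (W t' s') * v t')"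
    by (intro sum.cong refl sum.swap)
  also have "\<dots> = (\<Sum>s\<in>X. \<Sum>s'\<in>X. cnj (w s) * \<rho> s s' * w s')"
  proof (intro sum.cong refl)
    fix s s'
    have "cnj (w s) * \<rho> s s' * w s' = \<rho> s s' * (cnj (w s) * w s')"
      by (simp add: mult_ac)
    also have "cnj (w s) * w s' = (\<Sum>t\<in>Y. \<Sum>t'\<in>Y. (W t s * cnj (v t)) * (cnj (W t' s') * v t'))"
      unfolding w_def cnj_sum sum_product by simp
    finally show "(\<Sum>t\<in>Y. \<Sum>t'\<in>Y. cnj (v t) * W t s * \<rho> s s' * cnj (W t' s') * v t') = cnj (w s) * \<rho> s s' * w s'"
      by (simp add: sum_distrib_left mult_ac)
  qed
  finally show "0 \<le> (\<Sum>t\<in>Y. \<Sum>t'\<in>Y. cnj (v t) * induced_map X W \<rho> t t' * v t')"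
    using psdD[OF assms, of w] by simp
qed

lemma linear_on_ops_closed:
  "linear_on_ops X Y T \<Longrightarrow> \<sigma> \<in> operators X \<Longrightarrow> T \<sigma> \<in> operators Y"
  by (simp add: linear_on_ops_def)

lemma linear_on_ops_add:
  "linear_on_ops X Y T \<Longrightarrow> \<sigma> \<in> operators X \<Longrightarrow> \<tau> \<in> operators X \<Longrightarrow>
    T (\<lambda>i j. \<sigma> i j + \<tau> i j) = (\<lambda>i j. T \<sigma> i j + T \<tau> i j)"
  by (simp add: linear_on_ops_def)

lemma linear_on_ops_scale:
  "linear_on_ops X Y T \<Longrightarrow> \<sigma> \<in> operators X \<Longrightarrow> T (\<lambda>i j. c * \<sigma> i j) = (\<lambda>i j. c * T \<sigma> i j)"
  by (simp add: linear_on_ops_def)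

lemma linear_on_ops_zero:
  assumes "linear_on_ops X Y T"
  shows "T (\<lambda>i j. 0) = (\<lambda>i j. 0)"
proof -
  have "(\<lambda>i j. 0) \<in> operators X"
    by (simp add: operators_def)
  from linear_on_ops_scale[OF assms this, of 0] show ?thesis
    by simp
qed

lemma linear_on_ops_sum:
  assumes "linear_on_ops X Y T" "\<And>z. z \<in> Z \<Longrightarrow> \<sigma> z \<in> operators X"
  shows "T (\<lambda>i j. \<Sum>z\<in>Z. c z * \<sigma> z i j) = (\<lambda>i j. \<Sum>z\<in>Z. c z * T (\<sigma> z) i j)"
  using assms(2)
proof (induction Z rule: infinite_finite_induct)
  case (insert z Z)
  have op: "(\<lambda>i j. c z * \<sigma> z i j) \<in> operators X" "(\<lambda>i j. \<Sum>z\<in>Z. c z * \<sigma> z i j) \<in> operators X"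
    using operators_zero[OF insert.prems] by (auto intro!: operatorsI sum.neutral)
  have "T (\<lambda>i j. \<Sum>z\<in>insert z Z. c z * \<sigma> z i j) = T (\<lambda>i j. c z * \<sigma> z i j + (\<Sum>z\<in>Z. c z * \<sigma> z i j))"
    using insert.hyps by simp
  also have "\<dots> = (\<lambda>i j. T (\<lambda>i j. c z * \<sigma> z i j) i j + T (\<lambda>i j. \<Sum>z\<in>Z. c z * \<sigma> z i j) i j)"
    by (rule linear_on_ops_add[OF assms(1) op])
  also have "T (\<lambda>i j. c z * \<sigma> z i j) = (\<lambda>i j. c z * T (\<sigma> z) i j)"
    using insert.prems by (intro linear_on_ops_scale[OF assms(1)]) simp
  also have "T (\<lambda>i j. \<Sum>z\<in>Z. c z * \<sigma> z i j) = (\<lambda>i j. \<Sum>z\<in>Z. c z * T (\<sigma> z) i j)"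
    using insert by blast
  finally show ?case
    using insert.hyps by simp
qed (simp_all add: linear_on_ops_zero[OF assms(1)])

text \<open>Complete positivity is phrased with reference systems indexed by \<open>{..<k}\<close>,
  whereas the reference needed later is the composite system ABF.\<close>

lemma id_tensor_positive:
  assumes lin: "linear_on_ops X Y T" and cp: "completely_positive X Y T"
    and fin: "finite R" and \<rho>: "\<rho> \<in> positive_ops (R \<times> X)"
  shows "id_tensor T \<rho> \<in> positive_ops (R \<times> Y)"
proof -
  obtain h where h: "bij_betw h {..<card R} R"
    using bij_betw_from_nat_into_finite[OF fin] by blast
  let ?K = "{..<card R}"
  have bijX: "bij_betw (map_prod h id) (?K \<times> X) (R \<times> X)"
    by (intro bij_betw_map_prod h) auto
  have bijY: "bij_betw (map_prod h id) (?K \<times> Y) (R \<times> Y)"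
    by (intro bij_betw_map_prod h) auto
  have op: "\<rho> \<in> operators (R \<times> X)" and psd: "psd (R \<times> X) \<rho>"
    using \<rho> by (simp_all add: positive_ops_iff_psd)
  \<comment> \<open>The explicit cut-off supplies the support condition: outside \<open>?K\<close>
    the enumeration \<open>h\<close> may still take values in \<open>R\<close>.\<close>
  define \<rho>' where "\<rho>' = (\<lambda>i j. if i \<in> ?K \<times> X \<and> j \<in> ?K \<times> X then relabel (map_prod h id) \<rho> i j else 0)"
  have "psd (?K \<times> X) \<rho>'"
    using psd psd_reindex[OF bijX] psd_cong[of "?K \<times> X" \<rho>' "relabel (map_prod h id) \<rho>"]
    by (simp add: \<rho>'_def)
  then have "\<rho>' \<in> positive_ops (?K \<times> X)"
    by (auto simp: positive_ops_iff_psd operators_def \<rho>'_def)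
  then have "psd (?K \<times> Y) (id_tensor T \<rho>')"
    using cp by (auto simp: completely_positive_def positive_ops_iff_psd)
  moreover have "id_tensor T \<rho>' i j = relabel (map_prod h id) (id_tensor T \<rho>) i j"
    if "i \<in> ?K \<times> Y" "j \<in> ?K \<times> Y" for i j
  proof -
    have "(\<lambda>u v. \<rho>' (fst i, u) (fst j, v)) = (\<lambda>u v. \<rho> (h (fst i), u) (h (fst j), v))"
      using that op by (auto simp: \<rho>'_def relabel_def operators_def fun_eq_iff)
    then show ?thesis
      by (simp add: id_tensor_def relabel_def map_prod_def split_beta)
  qed
  ultimately have "psd (?K \<times> Y) (relabel (map_prod h id) (id_tensor T \<rho>))"
    by (rule iffD1[OF psd_cong, rotated])
  then have "psd (R \<times> Y) (id_tensor T \<rho>)"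
    unfolding psd_reindex[OF bijY] .
  moreover have "id_tensor T \<rho> \<in> operators (R \<times> Y)"
    unfolding operators_def
  proof (intro CollectI allI impI)
    fix i j assume nz: "id_tensor T \<rho> i j \<noteq> 0"
    obtain r s r' s' where ij: "i = (r, s)" "j = (r', s')" by (cases i; cases j)
    let ?B = "\<lambda>u v. \<rho> (r, u) (r', v)"
    have B: "T ?B s s' \<noteq> 0"
      using nz by (simp add: ij id_tensor_def)
    have "?B \<in> operators X"
      using op by (auto simp: operators_def)
    then have "T ?B \<in> operators Y"
      using lin by (auto simp: linear_on_ops_def)
    then have "s \<in> Y" "s' \<in> Y"
      using B by (auto simp: operators_def)
    moreover have "r \<in> R \<and> r' \<in> R"
    proof (rule ccontr)
      assume "\<not> (r \<in> R \<and> r' \<in> R)"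
      then have "?B = (\<lambda>u v. 0)"
        using op by (auto simp: operators_def fun_eq_iff)
      then show False
        using B linear_on_ops_zero[OF lin] by simp
    qed
    ultimately show "i \<in> R \<times> Y \<and> j \<in> R \<times> Y"
      by (simp add: ij)
  qed
  ultimately show ?thesis
    by (simp add: positive_ops_iff_psd)
qed

lemma isometry_inner:
  assumes "W \<in> isometries X Y" "finite X"
  shows "(\<Sum>t\<in>Y. (\<Sum>s\<in>X. W t s * c s) * cnj (\<Sum>s\<in>X. W t s * d s)) = (\<Sum>s\<in>X. c s * cnj (d s))"
proof -
  have "(\<Sum>t\<in>Y. (\<Sum>s\<in>X. W t s * c s) * cnj (\<Sum>s\<in>X. W t s * d s))
      = (\<Sum>t\<in>Y. \<Sum>s\<in>X. \<Sum>s'\<in>X. c s * cnj (d s') * (cnj (W t s') * W t s))"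
    unfolding cnj_sum sum_product by (simp add: mult_ac)
  also have "\<dots> = (\<Sum>s\<in>X. \<Sum>s'\<in>X. \<Sum>t\<in>Y. c s * cnj (d s') * (cnj (W t s') * W t s))"
    by (subst sum.swap, intro sum.cong refl, rule sum.swap)
  also have "\<dots> = (\<Sum>s\<in>X. \<Sum>s'\<in>X. if s' = s then c s * cnj (d s') else 0)"
    using assms(1) by (intro sum.cong) (auto simp: sum_distrib_left[symmetric] isometries_def)
  finally show ?thesis
    using assms(2) by (simp add: sum.delta)
qed

text \<open>The slices of \<open>W\<close> at a fixed environment index \<open>z\<close> are Kraus
  operators. Complete positivity is their operator sum, and trace preservation is the isometry
  condition.\<close>

lemma stinespring_quantum_operation:
  assumes W: "W \<in> isometries X (Z \<times> Y)" and fin: "finite X" "finite Y" "finite Z"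
  shows "quantum_operation X Y (\<lambda>\<sigma>. ptrace (\<lambda>y z. (z, y)) Z (induced_map X W \<sigma>))"
    (is "quantum_operation X Y ?T")
proof -
  have zero: "W (z, y) s = 0" if "y \<notin> Y \<or> s \<notin> X" for z y s
    using W that by (auto simp: isometries_def)
  have "?T \<sigma> \<in> operators Y" for \<sigma>
  proof -
    have "?T \<sigma> y y' = 0" if "y \<notin> Y \<or> y' \<notin> Y" for y y'
      using that zero by (auto simp: ptrace_def induced_map_def)
    then show ?thesis unfolding operators_def by blast
  qed
  then have "linear_on_ops X Y ?T"
    by (simp add: linear_on_ops_def ptrace_def induced_map_def sum.distrib sum_distrib_left algebra_simps)
  moreover have "completely_positive X Y ?T"
    unfolding completely_positive_def
  proof (intro allI ballI)
    fix k :: nat and \<rho> assume "\<rho> \<in> positive_ops ({..<k} \<times> X)"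
    then have op: "\<rho> \<in> operators ({..<k} \<times> X)" and psd: "psd ({..<k} \<times> X) \<rho>"
      by (simp_all add: positive_ops_iff_psd)
    \<comment> \<open>The identity on the reference tensored with the Kraus operator of index
      \<open>z\<close>.\<close>
    define K where "K = (\<lambda>z (r, y) (r', s). if r = (r'::nat) then W (z, y) s else 0)"
    have "psd ({..<k} \<times> Y) (\<lambda>i j. \<Sum>z\<in>Z. induced_map ({..<k} \<times> X) (K z) \<rho> i j)"
      by (intro psd_sum psd_induced_map psd)
    moreover have "(\<Sum>z\<in>Z. induced_map ({..<k} \<times> X) (K z) \<rho> i j) = id_tensor ?T \<rho> i j"
      if "i \<in> {..<k} \<times> Y" "j \<in> {..<k} \<times> Y" for i j
    proof -
      obtain r y r' y' where ij: "i = (r, y)" "j = (r', y')" by (cases i; cases j)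
      have "induced_map ({..<k} \<times> X) (K z) \<rho> i j
          = (\<Sum>s\<in>X. \<Sum>s'\<in>X. W (z, y) s * \<rho> (r, s) (r', s') * cnj (W (z, y') s'))" for z
      proof -
        have "induced_map ({..<k} \<times> X) (K z) \<rho> i j = (\<Sum>q<k. \<Sum>s\<in>X. \<Sum>q'<k. \<Sum>s'\<in>X.
            K z (r, y) (q, s) * \<rho> (q, s) (q', s') * cnj (K z (r', y') (q', s')))"
          by (simp add: induced_map_def ij sum.cartesian_product')
        also have "\<dots> = (\<Sum>q<k. if q = r then \<Sum>s\<in>X. \<Sum>q'<k. if q' = r' then \<Sum>s'\<in>X.
            W (z, y) s * \<rho> (q, s) (q', s') * cnj (W (z, y') s') else 0 else 0)"
        proof (intro sum.cong refl)
          fix q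
          have "(\<Sum>s'\<in>X. K z (r, y) (q, s) * \<rho> (q, s) (q', s') * cnj (K z (r', y') (q', s')))
              = (if q = r \<and> q' = r' then \<Sum>s'\<in>X. W (z, y) s * \<rho> (q, s) (q', s') * cnj (W (z, y') s') else 0)" for s q'
            by (auto simp: K_def)
          then show "(\<Sum>s\<in>X. \<Sum>q'<k. \<Sum>s'\<in>X. K z (r, y) (q, s) * \<rho> (q, s) (q', s') * cnj (K z (r', y') (q', s')))
              = (if q = r then \<Sum>s\<in>X. \<Sum>q'<k. if q' = r' then \<Sum>s'\<in>X.
                W (z, y) s * \<rho> (q, s) (q', s') * cnj (W (z, y') s') else 0 else 0)"
            by (cases "q = r") simp_all
        qed
        finally show ?thesis
          using that by (simp add: ij sum.delta)
      qed
      then show ?thesis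
        by (simp add: ij id_tensor_def ptrace_def induced_map_def)
    qed
    ultimately have "psd ({..<k} \<times> Y) (id_tensor ?T \<rho>)"
      by (rule iffD1[OF psd_cong, rotated])
    moreover have "id_tensor ?T \<rho> \<in> operators ({..<k} \<times> Y)"
    proof -
      have "id_tensor ?T \<rho> (r, y) (r', y') = 0" if "\<not> (r < k \<and> y \<in> Y \<and> r' < k \<and> y' \<in> Y)" for r y r' y'
      proof -
        have "W (z, y) s * \<rho> (r, s) (r', s') * cnj (W (z, y') s') = 0" for z s s'
          using that zero[of y s z] zero[of y' s' z] op by (auto simp: operators_def)
        then show ?thesis
          by (simp only: id_tensor_def ptrace_def induced_map_def prod.case sum.neutral_const)
      qed
      then show ?thesis by (auto simp: operators_def)
    qed
    ultimately show "id_tensor ?T \<rho> \<in> positive_ops ({..<k} \<times> Y)"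
      by (simp add: positive_ops_iff_psd)
  qed
  moreover have "trace_preserving X Y ?T"
    unfolding trace_preserving_def
  proof
    fix \<sigma>
    have "op_trace Y (?T \<sigma>) = (\<Sum>t\<in>Z \<times> Y. \<Sum>s\<in>X. \<Sum>s'\<in>X. W t s * \<sigma> s s' * cnj (W t s'))"
      unfolding op_trace_def ptrace_def induced_map_def sum.cartesian_product' by (rule sum.swap)
    also have "\<dots> = (\<Sum>s\<in>X. \<Sum>s'\<in>X. \<Sum>t\<in>Z \<times> Y. W t s * \<sigma> s s' * cnj (W t s'))"
      by (subst sum.swap, intro sum.cong refl, rule sum.swap)
    also have "\<dots> = (\<Sum>s\<in>X. \<Sum>s'\<in>X. \<sigma> s s' * (\<Sum>t\<in>Z \<times> Y. cnj (W t s') * W t s))"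
      by (simp add: sum_distrib_left mult_ac)
    also have "\<dots> = (\<Sum>s\<in>X. \<Sum>s'\<in>X. if s' = s then \<sigma> s s' else 0)"
      using W by (intro sum.cong) (auto simp: isometries_def)
    finally show "op_trace Y (?T \<sigma>) = op_trace X \<sigma>"
      using fin by (simp add: op_trace_def sum.delta)
  qed
  ultimately show ?thesis
    by (simp add: quantum_operation_def)
qed

section \<open>Interchanging the two complementary systems\<close>

lemma op_trace_ptrace:
  assumes "bij_betw (case_prod g) (X \<times> Z) Y"
  shows "op_trace X (ptrace g Z \<rho>) = op_trace Y \<rho>"
  unfolding op_trace_def ptrace_def sum.cartesian_product
  using sum.reindex_bij_betw[OF assms, of "\<lambda>y. \<rho> y y"] by (simp add: split_beta)

lemma op_trace_proj: "op_trace X (proj \<psi>) = of_real (\<Sum>i\<in>X. (cmod (\<psi> i))\<^sup>2)"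
  by (simp only: op_trace_def proj_def of_real_sum complex_norm_square)

lemma bij_betw_last_factor:
  "bij_betw (case_prod (\<lambda>(i, j, k) l. (i, j, k, l))) ((A \<times> B \<times> C) \<times> D) (A \<times> B \<times> C \<times> D)"
  by (rule bij_betwI[where g = "\<lambda>(i, j, k, l). ((i, j, k), l)"]) auto

lemma apply_E_entry:
  "apply_E T \<sigma> (i, j, m) (i', j', m') = T (\<lambda>u v. \<sigma> (i, j, u) (i', j', v)) m m'"
  by (simp add: apply_E_def relabel_def id_tensor_def)

lemma apply_E_4_entry:
  "apply_E_4 T \<sigma> (i, j, m, l) (i', j', m', l') = T (\<lambda>u v. \<sigma> (i, j, u, l) (i', j', v, l')) m m'"
  by (simp add: apply_E_4_def relabel_def id_tensor_def)

lemma J_down_lower: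
  fixes fa fb e' :: nat
  assumes "\<psi> \<in> purifications a b e ({..<fa} \<times> {..<fb}) \<rho>" "quantum_operation {..<e} {..<e'} T"
  shows "J_down a b e \<rho> \<le> ereal (cmi ({..<a} \<times> {..<fa}) ({..<b} \<times> {..<fb}) {..<e'}
    (relabel (\<lambda>((i, x), (j, y), k). (i, j, k, x, y)) (apply_E_4 T (proj \<psi>))))"
proof -
  have mem: "(fa, fb, \<psi>) \<in> {(fa, fb, \<psi>). \<psi> \<in> purifications a b e ({..<fa} \<times> {..<fb}) \<rho>}"
    "(e', T) \<in> quantum_ops_on e"
    using assms by (simp_all add: quantum_ops_on_def)
  show ?thesis
    unfolding J_down_def
    by (rule INF_lower2[OF mem(1)], unfold prod.case, rule INF_lower2[OF mem(2)], unfold prod.case, rule order_refl)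
qed

lemma J_down_greatest:
  assumes "\<And>(fa::nat) (fb::nat) \<psi> (e'::nat) T. \<psi> \<in> purifications a b e ({..<fa} \<times> {..<fb}) \<rho> \<Longrightarrow>
    quantum_operation {..<e} {..<e'} T \<Longrightarrow>
    c \<le> ereal (cmi ({..<a} \<times> {..<fa}) ({..<b} \<times> {..<fb}) {..<e'}
      (relabel (\<lambda>((i, x), (j, y), k). (i, j, k, x, y)) (apply_E_4 T (proj \<psi>))))"
  shows "c \<le> J_down a b e \<rho>"
  unfolding J_down_def quantum_ops_on_def using assms by (auto intro!: INF_greatest)

lemma J_down_star_lower:
  fixes ea eb f :: nat
  assumes "W \<in> isometries {..<e} ({..<ea} \<times> {..<eb})" "\<omega> \<in> extensions a b e f \<rho>"
  shows "J_down_star a b e \<rho> \<le> ereal (cmi ({..<a} \<times> {..<ea}) ({..<b} \<times> {..<eb}) {..<f}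
    (relabel (\<lambda>((i, x), (j, y), l). (i, j, (x, y), l)) (apply_E_4 (induced_map {..<e} W) \<omega>)))"
proof -
  have mem: "(ea, eb, W) \<in> {(ea, eb, W). W \<in> isometries {..<e} ({..<ea} \<times> {..<eb})}"
    "(f, \<omega>) \<in> {(f, \<omega>). \<omega> \<in> extensions a b e f \<rho>}"
    using assms by simp_all
  show ?thesis
    unfolding J_down_star_def
    by (rule INF_lower2[OF mem(1)], unfold prod.case, rule INF_lower2[OF mem(2)], unfold prod.case, rule order_refl)
qed

lemma J_down_star_greatest:
  assumes "\<And>(ea::nat) (eb::nat) W (f::nat) \<omega>. W \<in> isometries {..<e} ({..<ea} \<times> {..<eb}) \<Longrightarrow>
    \<omega> \<in> extensions a b e f \<rho> \<Longrightarrow>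
    c \<le> ereal (cmi ({..<a} \<times> {..<ea}) ({..<b} \<times> {..<eb}) {..<f}
      (relabel (\<lambda>((i, x), (j, y), l). (i, j, (x, y), l)) (apply_E_4 (induced_map {..<e} W) \<omega>)))"
  shows "c \<le> J_down_star a b e \<rho>"
  unfolding J_down_star_def using assms by (auto intro!: INF_greatest)

text \<open>Supplies the support hypothesis of \<open>cmi_superset\<close> for the original
  \<open>F\<^sub>A\<close> and \<open>F\<^sub>B\<close>. Outside these sets the block handed to
  \<open>T\<close> is zero, and linearity keeps it zero.\<close>

lemma purification_output_operators:
  assumes \<psi>: "\<psi> \<in> purifications a b e (FA \<times> FB) \<rho>" and T: "quantum_operation {..<e} Y T"
  shows "relabel (\<lambda>((i, x), (j, y), k). (i, j, k, x, y)) (apply_E_4 T (proj \<psi>))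
    \<in> operators (({..<a} \<times> FA) \<times> ({..<b} \<times> FB) \<times> Y)" (is "?\<sigma> \<in> operators ?X")
proof -
  have lin: "linear_on_ops {..<e} Y T"
    using T by (simp add: quantum_operation_def)
  have nz: "\<forall>i. \<psi> i \<noteq> 0 \<longrightarrow> i \<in> {..<a} \<times> {..<b} \<times> {..<e} \<times> FA \<times> FB"
    using \<psi> by (simp add: purifications_def unit_kets_def)
  have supp: "\<psi> (i, j, k, x, y) = 0" if "\<not> (i < a \<and> j < b \<and> k < e \<and> x \<in> FA \<and> y \<in> FB)" for i j k x y
    using spec[OF nz, of "(i, j, k, x, y)"] that by auto
  have "?\<sigma> ((i, x), (j, y), m) ((i', x'), (j', y'), m') = 0"
    if "((i, x), (j, y), m) \<notin> ?X \<or> ((i', x'), (j', y'), m') \<notin> ?X" for i x j y m i' x' j' y' m'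
  proof -
    let ?B = "\<lambda>u v. \<psi> (i, j, u, x, y) * cnj (\<psi> (i', j', v, x', y'))"
    have entry: "?\<sigma> ((i, x), (j, y), m) ((i', x'), (j', y'), m') = T ?B m m'"
      by (simp add: relabel_def apply_E_4_entry proj_def)
    have "?B \<in> operators {..<e}"
      using supp by (intro operatorsI) auto
    then have out: "T ?B \<in> operators Y"
      by (rule linear_on_ops_closed[OF lin])
    show ?thesis
    proof (cases "m \<in> Y \<and> m' \<in> Y")
      case True
      then have "?B = (\<lambda>u v. 0)"
        using that supp by (auto simp: fun_eq_iff)
      then show ?thesis
        unfolding entry by (simp only: linear_on_ops_zero[OF lin])
    next
      case False
      then show ?thesis
        unfolding entry by (intro operators_zero[OF out]) auto
    qed
  qed
  then show ?thesis
    by (intro operatorsI) (metis surj_pair)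
qed

text \<open>The two purifications and the swap are condensed into entry formulas for a single ket.
  For \<open>\<rho>\<^sub>2\<close> the system F plays the part of E, so its functions and sets are
  taken at \<open>a b f\<close>.\<close>

locale swapped_states =
  fixes a b e f :: nat
    and \<rho>\<^sub>1 \<rho>\<^sub>2 :: "(nat \<times> nat \<times> nat) op"
    and \<phi> :: "(nat \<times> nat \<times> nat \<times> nat) ket"
  assumes ket: "\<And>i j k l. \<phi> (i, j, k, l) \<noteq> 0 \<Longrightarrow> i < a \<and> j < b \<and> k < e \<and> l < f"
    and \<rho>1_entry: "\<And>i j k i' j' k'.
      \<rho>\<^sub>1 (i, j, k) (i', j', k') = (\<Sum>l<f. \<phi> (i, j, k, l) * cnj (\<phi> (i', j', k', l)))"
    and \<rho>2_entry: "\<And>i j l i' j' l'.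
      \<rho>\<^sub>2 (i, j, l) (i', j', l') = (\<Sum>k<e. \<phi> (i, j, k, l) * cnj (\<phi> (i', j', k, l')))"
    and trace_\<rho>1: "op_trace ({..<a} \<times> {..<b} \<times> {..<e}) \<rho>\<^sub>1 = 1"
    and trace_\<rho>2: "op_trace ({..<a} \<times> {..<b} \<times> {..<f}) \<rho>\<^sub>2 = 1"
begin

text \<open>Fixing the indices of A, B and F on both sides of the projector leaves an operator on E.
  The action of \<open>T\<close> on the pure state is determined by these blocks.\<close>

definition block :: "nat \<times> nat \<times> nat \<Rightarrow> nat \<times> nat \<times> nat \<Rightarrow> nat op" where
  "block = (\<lambda>(i, j, l) (i', j', l') k k'. \<phi> (i, j, k, l) * cnj (\<phi> (i', j', k', l')))"

definition dilate :: "(nat \<times> nat \<Rightarrow> nat \<Rightarrow> complex) \<Rightarrow> (nat \<times> nat \<times> nat \<times> nat \<times> nat) ket" where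
  "dilate W = (\<lambda>(i, j, k, g). \<Sum>l<f. W g l * \<phi> (i, j, k, l))"

text \<open>The swap moves the output of \<open>T\<close> to the last position: F now stands where
  extensions expect E, and the output is the extending system.\<close>

definition extend :: "(nat op \<Rightarrow> nat op) \<Rightarrow> (nat \<times> nat \<times> nat \<times> nat) op" where
  "extend T = swap_EF (apply_E_4 T (proj \<phi>))"

section \<open>Operations on E and extensions of \<open>\<rho>\<^sub>2\<close>\<close>

lemma extend_entry:
  "extend T (i, j, l, m) (i', j', l', m') = T (block (i, j, l) (i', j', l')) m m'"
  by (simp add: extend_def swap_EF_def relabel_def apply_E_4_entry block_def proj_def)

lemma block_operators: "block x y \<in> operators {..<e}"
  using ket by (cases x; cases y) (auto simp: block_def operators_def)

text \<open>Positivity is complete positivity with reference ABF, the marginal is trace preservation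
  block by block, and the normalisation is inherited from the marginal.\<close>

lemma extend_extension:
  assumes T: "quantum_operation {..<e} {..<e'} T"
  shows "extend T \<in> extensions a b f e' \<rho>\<^sub>2"
proof -
  let ?R = "{..<a} \<times> {..<b} \<times> {..<f}"
  have lin: "linear_on_ops {..<e} {..<e'} T" and cp: "completely_positive {..<e} {..<e'} T"
    and tp: "trace_preserving {..<e} {..<e'} T"
    using T by (simp_all add: quantum_operation_def)
  have red: "ptrace (\<lambda>(i, j, k) l. (i, j, k, l)) {..<e'} (extend T) = \<rho>\<^sub>2"
  proof (intro ext, clarify)
    fix i j l i' j' l'
    have "ptrace (\<lambda>(i, j, k) l. (i, j, k, l)) {..<e'} (extend T) (i, j, l) (i', j', l')
        = op_trace {..<e'} (T (block (i, j, l) (i', j', l')))"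
      by (simp add: ptrace_def extend_entry op_trace_def)
    also have "\<dots> = op_trace {..<e} (block (i, j, l) (i', j', l'))"
      using tp block_operators by (simp add: trace_preserving_def)
    finally show "ptrace (\<lambda>(i, j, k) l. (i, j, k, l)) {..<e'} (extend T) (i, j, l) (i', j', l')
        = \<rho>\<^sub>2 (i, j, l) (i', j', l')"
      by (simp add: op_trace_def block_def \<rho>2_entry)
  qed
  define \<sigma> where "\<sigma> = proj (\<lambda>((i, j, l), k). \<phi> (i, j, k, l))"
  have "\<sigma> \<in> positive_ops (?R \<times> {..<e})"
    unfolding positive_ops_iff_psd \<sigma>_def using ket psd_proj
    by (auto simp: operators_def proj_def)
  then have "id_tensor T \<sigma> \<in> positive_ops (?R \<times> {..<e'})"
    by (intro id_tensor_positive[OF lin cp]) auto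
  then have pos: "id_tensor T \<sigma> \<in> operators (?R \<times> {..<e'})" "psd (?R \<times> {..<e'}) (id_tensor T \<sigma>)"
    by (simp_all add: positive_ops_iff_psd)
  have eq: "extend T = relabel (\<lambda>(i, j, l, m). ((i, j, l), m)) (id_tensor T \<sigma>)"
    by (auto simp: fun_eq_iff extend_entry relabel_def id_tensor_def \<sigma>_def proj_def block_def)
  have "psd ({..<a} \<times> {..<b} \<times> {..<f} \<times> {..<e'}) (extend T)"
    unfolding eq
    by (rule iffD2[OF psd_reindex pos(2)]) (rule bij_betwI[where g = "\<lambda>((i, j, l), m). (i, j, l, m)"], auto)
  moreover have "extend T \<in> operators ({..<a} \<times> {..<b} \<times> {..<f} \<times> {..<e'})"
    unfolding eq relabel_def
    by (rule operatorsI) (auto intro!: operators_zero[OF pos(1)])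
  moreover have "op_trace ({..<a} \<times> {..<b} \<times> {..<f} \<times> {..<e'}) (extend T) = 1"
    using op_trace_ptrace[OF bij_betw_last_factor, of "{..<a}" "{..<b}" "{..<f}" "{..<e'}" "extend T"] trace_\<rho>2
    by (simp only: red)
  ultimately show ?thesis
    using red by (simp add: extensions_def density_ops_def positive_ops_iff_psd)
qed

text \<open>E on one side, and the purifying system of dimension \<open>n\<close> together with the
  extending system on the other, both purify \<open>\<rho>\<^sub>2\<close>. The \<open>e\<close>
  additional dimensions belong to the environment that \<open>T\<close> traces out, so the output
  dimension remains \<open>e'\<close>.\<close>

lemma extension_is_extend:
  assumes \<omega>: "\<omega> \<in> extensions a b f e' \<rho>\<^sub>2"
  shows "\<exists>T. quantum_operation {..<e} {..<e'} T \<and> \<omega> = extend T"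
proof -
  let ?R = "{..<a} \<times> {..<b} \<times> {..<f}" and ?X = "{..<a} \<times> {..<b} \<times> {..<f} \<times> {..<e'}"
  have op: "\<omega> \<in> operators ?X" and psd: "psd ?X \<omega>" and tr: "op_trace ?X \<omega> = 1"
    and red: "ptrace (\<lambda>(i, j, k) l. (i, j, k, l)) {..<e'} \<omega> = \<rho>\<^sub>2"
    using \<omega> by (simp_all add: extensions_def density_ops_def positive_ops_iff_psd)
  \<comment> \<open>The completion of the isometry is placed at basis vector 0 of the output system,
    which must therefore exist.\<close>
  have "e' \<noteq> 0"
    using tr by (cases "e' = 0") (auto simp: op_trace_def)
  have "finite ?X" by simp
  obtain n :: nat and u where u: "\<forall>x\<in>?X. \<forall>y\<in>?X. \<omega> x y = (\<Sum>g<n. u g x * cnj (u g y))"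
    using psd_decomposition[OF \<open>finite ?X\<close> psd] by (elim exE)
  \<comment> \<open>The purifying index \<open>g\<close> precedes the output index \<open>m\<close>,
    matching the order of environment and output in the Stinespring form. The cut-off to 0 provides
    the required support.\<close>
  define \<psi> where "\<psi> = (\<lambda>(i, j, l) (g, m). if (i, j, l, m) \<in> ?X \<and> g < n then u g (i, j, l, m) else 0)"
  have \<omega>_entry: "\<omega> (i, j, l, m) (i', j', l', m')
      = (\<Sum>g<n. \<psi> (i, j, l) (g, m) * cnj (\<psi> (i', j', l') (g, m')))" for i j l m i' j' l' m'
    using u operators_zero[OF op] by (cases "(i, j, l, m) \<in> ?X \<and> (i', j', l', m') \<in> ?X") (auto simp: \<psi>_def)
  let ?\<phi> = "\<lambda>(i, j, l) k. \<phi> (i, j, k, l)"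
  have gram: "(\<Sum>k<e. ?\<phi> r k * cnj (?\<phi> r' k)) = (\<Sum>g\<in>{..<n} \<times> {..<e'}. \<psi> r g * cnj (\<psi> r' g))" for r r'
  proof -
    obtain i j l i' j' l' where r: "r = (i, j, l)" "r' = (i', j', l')" by (cases r; cases r')
    have "(\<Sum>k<e. ?\<phi> r k * cnj (?\<phi> r' k)) = (\<Sum>m<e'. \<omega> (i, j, l, m) (i', j', l', m))"
      using fun_cong[OF fun_cong[OF red, of "(i, j, l)"], of "(i', j', l')"]
      by (simp add: r \<rho>2_entry ptrace_def)
    then show ?thesis
      unfolding \<omega>_entry by (subst (asm) sum.swap) (simp add: r sum.cartesian_product)
  qed
  have "\<exists>W\<in>isometries {..<e} ({..<n + e} \<times> {..<e'}). \<forall>r\<in>?R. \<forall>g. \<psi> r g = (\<Sum>k<e. W g k * ?\<phi> r k)"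
  proof (rule purification_isometry)
    show "(0::nat) \<in> {..<e'}" using \<open>e' \<noteq> 0\<close> by simp
    show "\<psi> r g = 0" if "g \<notin> {..<n} \<times> {..<e'}" for r g
      using that by (cases r; cases g) (auto simp: \<psi>_def)
  qed (simp_all add: gram)
  then obtain W where W: "W \<in> isometries {..<e} ({..<n + e} \<times> {..<e'})"
    and \<psi>W: "\<forall>r\<in>?R. \<forall>g. \<psi> r g = (\<Sum>k<e. W g k * ?\<phi> r k)"
    by (elim bexE)
  define T where "T = (\<lambda>\<sigma>. ptrace (\<lambda>y z. (z, y)) {..<n + e} (induced_map {..<e} W \<sigma>))"
  have T: "quantum_operation {..<e} {..<e'} T"
    unfolding T_def by (rule stinespring_quantum_operation[OF W]) auto
  have \<psi>W': "\<psi> (i, j, l) g = (\<Sum>k<e. W g k * \<phi> (i, j, k, l))" for i j l g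
  proof (cases "(i, j, l) \<in> ?R")
    case False
    then have "\<phi> (i, j, k, l) = 0" for k
      using ket by auto
    then show ?thesis
      using False by (cases g) (auto simp: \<psi>_def)
  next
    case True
    then show ?thesis
      using bspec[OF \<psi>W True] by (cases g) simp
  qed
  have "\<omega> (i, j, l, m) (i', j', l', m') = extend T (i, j, l, m) (i', j', l', m')" for i j l m i' j' l' m'
  proof -
    have "\<omega> (i, j, l, m) (i', j', l', m')
        = (\<Sum>g<n + e. \<psi> (i, j, l) (g, m) * cnj (\<psi> (i', j', l') (g, m')))"
      unfolding \<omega>_entry by (intro sum.mono_neutral_left) (auto simp: \<psi>_def)
    then show ?thesis
      unfolding \<psi>W' cnj_sum sum_product
      by (simp add: extend_entry T_def ptrace_def induced_map_def block_def mult_ac)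
  qed
  then have "\<omega> = extend T"
    by (auto simp: fun_eq_iff)
  with T show ?thesis by blast
qed

text \<open>Tracing out F sums the blocks with equal F indices, and linearity takes this sum through
  \<open>T\<close>. The outcome is an equality of operators, so every functional of them
  agrees.\<close>

lemma extend_reduced:
  assumes T: "quantum_operation {..<e} {..<e'} T"
  shows "ptrace (\<lambda>(i, j, l) k. (i, j, k, l)) {..<f} (extend T) = apply_E T \<rho>\<^sub>1"
proof (intro ext, clarify)
  fix i j m i' j' m'
  have lin: "linear_on_ops {..<e} {..<e'} T"
    using T by (simp add: quantum_operation_def)
  have "(\<lambda>u v. \<rho>\<^sub>1 (i, j, u) (i', j', v)) = (\<lambda>u v. \<Sum>l<f. 1 * block (i, j, l) (i', j', l) u v)"
    by (simp add: \<rho>1_entry block_def)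
  then show "ptrace (\<lambda>(i, j, l) k. (i, j, k, l)) {..<f} (extend T) (i, j, m) (i', j', m')
      = apply_E T \<rho>\<^sub>1 (i, j, m) (i', j', m')"
    using linear_on_ops_sum[OF lin, of "{..<f}" "\<lambda>l. block (i, j, l) (i', j', l)" "\<lambda>_. 1"] block_operators
    by (simp add: ptrace_def extend_entry apply_E_entry)
qed

section \<open>Isometries on F and purifications of \<open>\<rho>\<^sub>1\<close>\<close>

lemma dilate_purification:
  assumes W: "W \<in> isometries {..<f} (FA \<times> FB)"
  shows "dilate W \<in> purifications a b e (FA \<times> FB) \<rho>\<^sub>1"
proof -
  let ?X = "{..<a} \<times> {..<b} \<times> {..<e} \<times> FA \<times> FB"
  have red: "ptrace (\<lambda>(i, j, k) l. (i, j, k, l)) (FA \<times> FB) (proj (dilate W)) = \<rho>\<^sub>1"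
    using isometry_inner[OF W] by (auto simp: fun_eq_iff ptrace_def proj_def dilate_def \<rho>1_entry)
  have "of_real (\<Sum>i\<in>?X. (cmod (dilate W i))\<^sup>2) = (1::complex)"
    using op_trace_ptrace[OF bij_betw_last_factor, of "{..<a}" "{..<b}" "{..<e}" "FA \<times> FB" "proj (dilate W)"] trace_\<rho>1
    by (simp only: red op_trace_proj)
  then have "(\<Sum>i\<in>?X. (cmod (dilate W i))\<^sup>2) = 1"
    by (simp only: of_real_eq_1_iff)
  moreover have "i \<in> ?X" if "dilate W i \<noteq> 0" for i
  proof -
    obtain p q k x y where i: "i = (p, q, k, x, y)" by (cases i)
    obtain l where "W (x, y) l * \<phi> (p, q, k, l) \<noteq> 0"
      using \<open>dilate W i \<noteq> 0\<close> unfolding i dilate_def by (auto elim: sum.not_neutral_contains_not_neutral)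
    then show ?thesis
      using W ket by (auto simp: i isometries_def)
  qed
  ultimately show ?thesis
    using red by (auto simp: purifications_def unit_kets_def)
qed

text \<open>Maps on E and on F commute: both factors \<open>W\<close> expand into a double sum of
  scalars times blocks, and linearity takes that sum through \<open>T\<close>.\<close>

lemma apply_isometry_extend:
  assumes T: "quantum_operation {..<e} {..<e'} T"
  shows "relabel (\<lambda>((i, x), (j, y), l). (i, j, (x, y), l)) (apply_E_4 (induced_map {..<f} W) (extend T))
    = relabel (\<lambda>((i, x), (j, y), k). (i, j, k, x, y)) (apply_E_4 T (proj (dilate W)))"
proof (intro ext, clarify)
  fix i x j y m i' x' j' y' m'
  have lin: "linear_on_ops {..<e} {..<e'} T"
    using T by (simp add: quantum_operation_def)
  let ?B = "\<lambda>(l, l'). block (i, j, l) (i', j', l')" and ?c = "\<lambda>(l, l'). W (x, y) l * cnj (W (x', y') l')"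
  have "(\<lambda>u v. proj (dilate W) (i, j, u, x, y) (i', j', v, x', y'))
      = (\<lambda>u v. \<Sum>z\<in>{..<f} \<times> {..<f}. ?c z * ?B z u v)"
    unfolding proj_def dilate_def block_def
    by (simp add: cnj_sum sum_product sum.cartesian_product' mult_ac)
  moreover have "T (\<lambda>u v. \<Sum>z\<in>{..<f} \<times> {..<f}. ?c z * ?B z u v)
      = (\<lambda>u v. \<Sum>z\<in>{..<f} \<times> {..<f}. ?c z * T (?B z) u v)"
    by (rule linear_on_ops_sum[OF lin]) (auto intro: block_operators)
  ultimately show "relabel (\<lambda>((i, x), (j, y), l). (i, j, (x, y), l)) (apply_E_4 (induced_map {..<f} W) (extend T))
      ((i, x), (j, y), m) ((i', x'), (j', y'), m')
    = relabel (\<lambda>((i, x), (j, y), k). (i, j, k, x, y)) (apply_E_4 T (proj (dilate W)))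
      ((i, x), (j, y), m) ((i', x'), (j', y'), m')"
    by (simp add: relabel_def apply_E_4_entry induced_map_def extend_entry sum.cartesian_product' mult_ac)
qed

text \<open>The summand \<open>f\<close> in \<open>fa + f\<close> holds the rows that complete the
  partial isometry. They all sit at index 0 of \<open>F\<^sub>B\<close>, so that factor keeps its
  dimension.\<close>

lemma purification_is_dilation:
  assumes \<psi>: "\<psi> \<in> purifications a b e ({..<fa} \<times> {..<fb}) \<rho>\<^sub>1"
  shows "\<exists>W\<in>isometries {..<f} ({..<fa + f} \<times> {..<fb}). \<psi> = dilate W"
proof -
  let ?R = "{..<a} \<times> {..<b} \<times> {..<e}"
  let ?\<psi> = "\<lambda>(i, j, k) g. \<psi> (i, j, k, g)" and ?\<phi> = "\<lambda>(i, j, k) l. \<phi> (i, j, k, l)"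
  have nz: "\<forall>i. \<psi> i \<noteq> 0 \<longrightarrow> i \<in> {..<a} \<times> {..<b} \<times> {..<e} \<times> {..<fa} \<times> {..<fb}"
    and norm: "(\<Sum>i\<in>{..<a} \<times> {..<b} \<times> {..<e} \<times> {..<fa} \<times> {..<fb}. (cmod (\<psi> i))\<^sup>2) = 1"
    and red: "ptrace (\<lambda>(i, j, k) l. (i, j, k, l)) ({..<fa} \<times> {..<fb}) (proj \<psi>) = \<rho>\<^sub>1"
    using \<psi> by (simp_all add: purifications_def unit_kets_def)
  have supp: "\<psi> (i, j, k, g) = 0" if "(i, j, k, g) \<notin> {..<a} \<times> {..<b} \<times> {..<e} \<times> {..<fa} \<times> {..<fb}" for i j k g
    using nz that by blast
  \<comment> \<open>Normalisation excludes an empty \<open>F\<^sub>B\<close>, so index 0 is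
    available for the extra rows.\<close>
  have "fb \<noteq> 0"
    using norm by (cases "fb = 0") auto
  have gram: "(\<Sum>l<f. ?\<phi> r l * cnj (?\<phi> r' l)) = (\<Sum>g\<in>{..<fa} \<times> {..<fb}. ?\<psi> r g * cnj (?\<psi> r' g))" for r r'
    using fun_cong[OF fun_cong[OF red, of r], of r']
    by (cases r; cases r') (simp add: \<rho>1_entry ptrace_def proj_def)
  have "\<exists>W\<in>isometries {..<f} ({..<fa + f} \<times> {..<fb}). \<forall>r\<in>?R. \<forall>g. ?\<psi> r g = (\<Sum>l<f. W g l * ?\<phi> r l)"
  proof (rule purification_isometry)
    show "(0::nat) \<in> {..<fb}" using \<open>fb \<noteq> 0\<close> by simp
    show "?\<psi> r g = 0" if "g \<notin> {..<fa} \<times> {..<fb}" for r g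
      using that supp by (cases r) auto
  qed (simp_all only: gram finite_lessThan finite_cartesian_product)
  then obtain W where W: "W \<in> isometries {..<f} ({..<fa + f} \<times> {..<fb})"
    and \<psi>W: "\<forall>r\<in>?R. \<forall>g. ?\<psi> r g = (\<Sum>l<f. W g l * ?\<phi> r l)"
    by (elim bexE)
  have "\<psi> (i, j, k, g) = dilate W (i, j, k, g)" for i j k g
  proof (cases "(i, j, k) \<in> ?R")
    case True
    then show ?thesis using bspec[OF \<psi>W True] by (cases g) (simp add: dilate_def)
  next
    case False
    then have "\<phi> (i, j, k, l) = 0" for l
      using ket by auto
    moreover have "\<psi> (i, j, k, g) = 0"
      by (rule supp) (use False in auto)
    ultimately show ?thesis
      by (simp add: dilate_def)
  qed
  then have "\<psi> = dilate W"
    by (auto simp: fun_eq_iff)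
  with W show ?thesis by blast
qed

text \<open>Tracing out E commutes with \<open>W\<close> on F. This identifies the operators whose
  separability defines \<open>S_J\<close> and \<open>S_J_star\<close>.\<close>

lemma dilate_reduced:
  "ptrace (\<lambda>((i, x), (j, y)) k. (i, j, k, x, y)) {..<e} (proj (dilate W))
    = relabel (\<lambda>((i, x), (j, y)). (i, j, x, y)) (apply_E (induced_map {..<f} W) \<rho>\<^sub>2)"
proof (intro ext, clarify)
  fix i x j y i' x' j' y'
  have "ptrace (\<lambda>((i, x), (j, y)) k. (i, j, k, x, y)) {..<e} (proj (dilate W)) ((i, x), (j, y)) ((i', x'), (j', y'))
      = (\<Sum>k<e. (\<Sum>l<f. W (x, y) l * \<phi> (i, j, k, l)) * cnj (\<Sum>l<f. W (x', y') l * \<phi> (i', j', k, l)))"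
    by (simp add: ptrace_def proj_def dilate_def)
  also have "\<dots> = (\<Sum>k<e. \<Sum>l<f. \<Sum>l'<f. W (x, y) l * (\<phi> (i, j, k, l) * cnj (\<phi> (i', j', k, l'))) * cnj (W (x', y') l'))"
    unfolding cnj_sum sum_product by (simp add: mult_ac)
  also have "\<dots> = (\<Sum>l<f. \<Sum>l'<f. \<Sum>k<e. W (x, y) l * (\<phi> (i, j, k, l) * cnj (\<phi> (i', j', k, l'))) * cnj (W (x', y') l'))"
    by (rule trans[OF sum.swap], rule sum.cong[OF refl], rule sum.swap)
  also have "\<dots> = relabel (\<lambda>((i, x), (j, y)). (i, j, x, y)) (apply_E (induced_map {..<f} W) \<rho>\<^sub>2)
      ((i, x), (j, y)) ((i', x'), (j', y'))"
    by (simp add: relabel_def apply_E_entry induced_map_def \<rho>2_entry sum_distrib_left sum_distrib_right)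
  finally show "ptrace (\<lambda>((i, x), (j, y)) k. (i, j, k, x, y)) {..<e} (proj (dilate W)) ((i, x), (j, y)) ((i', x'), (j', y'))
      = relabel (\<lambda>((i, x), (j, y)). (i, j, x, y)) (apply_E (induced_map {..<f} W) \<rho>\<^sub>2)
        ((i, x), (j, y)) ((i', x'), (j', y'))" .
qed

section \<open>Equality of the infima and equivalence of the memberships\<close>

lemma I_down_eq: "I_down a b e \<rho>\<^sub>1 = I_down_star a b f \<rho>\<^sub>2"
proof (rule antisym)
  show "I_down a b e \<rho>\<^sub>1 \<le> I_down_star a b f \<rho>\<^sub>2"
    unfolding I_down_star_def
  proof (rule INF_greatest, clarify)
    fix e' \<omega> assume "\<omega> \<in> extensions a b f e' \<rho>\<^sub>2"
    then obtain T where T: "quantum_operation {..<e} {..<e'} T" "\<omega> = extend T"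
      using extension_is_extend by blast
    then show "I_down a b e \<rho>\<^sub>1 \<le> ereal (cmi {..<a} {..<b} {..<e'} (ptrace (\<lambda>(i, j, l) k. (i, j, k, l)) {..<f} \<omega>))"
      unfolding I_down_def by (intro INF_lower2[of "(e', T)"]) (auto simp: quantum_ops_on_def extend_reduced)
  qed
  show "I_down_star a b f \<rho>\<^sub>2 \<le> I_down a b e \<rho>\<^sub>1"
    unfolding I_down_def
  proof (rule INF_greatest, clarify)
    fix e' T assume "(e', T) \<in> quantum_ops_on e"
    then have T: "quantum_operation {..<e} {..<e'} T" by (simp add: quantum_ops_on_def)
    then show "I_down_star a b f \<rho>\<^sub>2 \<le> ereal (cmi {..<a} {..<b} {..<e'} (apply_E T \<rho>\<^sub>1))"
      unfolding I_down_star_def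
      by (intro INF_lower2[of "(e', extend T)"]) (auto simp: extend_reduced extend_extension)
  qed
qed

text \<open>Both sides test the same operator at the same dimension \<open>e'\<close>, so being a
  state and having zero conditional mutual information transfer together.\<close>

lemma S_I_iff:
  assumes "\<rho>\<^sub>1 \<in> S_all a b e" "\<rho>\<^sub>2 \<in> S_all a b f"
  shows "\<rho>\<^sub>1 \<in> S_I a b e \<longleftrightarrow> \<rho>\<^sub>2 \<in> S_I_star a b f"
proof -
  have "(\<exists>e'. \<exists>T. quantum_operation {..<e} {..<e'} T \<and> apply_E T \<rho>\<^sub>1 \<in> S_Markov a b e') \<longleftrightarrow>
      (\<exists>e'. \<exists>\<omega>\<in>extensions a b f e' \<rho>\<^sub>2. ptrace (\<lambda>(i, j, l) k. (i, j, k, l)) {..<f} \<omega> \<in> S_Markov a b e')"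
  proof (intro iff_exI iffI)
    fix e' assume "\<exists>T. quantum_operation {..<e} {..<e'} T \<and> apply_E T \<rho>\<^sub>1 \<in> S_Markov a b e'"
    then obtain T where T: "quantum_operation {..<e} {..<e'} T" "apply_E T \<rho>\<^sub>1 \<in> S_Markov a b e'"
      by blast
    then show "\<exists>\<omega>\<in>extensions a b f e' \<rho>\<^sub>2. ptrace (\<lambda>(i, j, l) k. (i, j, k, l)) {..<f} \<omega> \<in> S_Markov a b e'"
      by (intro bexI[OF _ extend_extension[OF T(1)]]) (simp add: extend_reduced)
  next
    fix e' assume "\<exists>\<omega>\<in>extensions a b f e' \<rho>\<^sub>2. ptrace (\<lambda>(i, j, l) k. (i, j, k, l)) {..<f} \<omega> \<in> S_Markov a b e'"
    then obtain \<omega> where \<omega>: "\<omega> \<in> extensions a b f e' \<rho>\<^sub>2"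
      and M: "ptrace (\<lambda>(i, j, l) k. (i, j, k, l)) {..<f} \<omega> \<in> S_Markov a b e'"
      by blast
    obtain T where T: "quantum_operation {..<e} {..<e'} T" "\<omega> = extend T"
      using extension_is_extend[OF \<omega>] by blast
    then show "\<exists>T. quantum_operation {..<e} {..<e'} T \<and> apply_E T \<rho>\<^sub>1 \<in> S_Markov a b e'"
      using M by (intro exI[of _ T]) (simp add: extend_reduced)
  qed
  then show ?thesis
    using assms by (auto simp: S_I_def S_I_star_def quantum_ops_on_def)
qed

lemma J_down_eq: "J_down a b e \<rho>\<^sub>1 = J_down_star a b f \<rho>\<^sub>2"
proof (rule antisym)
  show "J_down a b e \<rho>\<^sub>1 \<le> J_down_star a b f \<rho>\<^sub>2"
  proof (rule J_down_star_greatest)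
    fix ea eb :: nat and W e' \<omega>
    assume W: "W \<in> isometries {..<f} ({..<ea} \<times> {..<eb})" and "\<omega> \<in> extensions a b f e' \<rho>\<^sub>2"
    then obtain T where T: "quantum_operation {..<e} {..<e'} T" "\<omega> = extend T"
      using extension_is_extend by blast
    show "J_down a b e \<rho>\<^sub>1 \<le> ereal (cmi ({..<a} \<times> {..<ea}) ({..<b} \<times> {..<eb}) {..<e'}
          (relabel (\<lambda>((i, x), (j, y), l). (i, j, (x, y), l)) (apply_E_4 (induced_map {..<f} W) \<omega>)))"
      unfolding T(2) apply_isometry_extend[OF T(1)]
      by (rule J_down_lower[OF dilate_purification[OF W] T(1)])
  qed
  show "J_down_star a b f \<rho>\<^sub>2 \<le> J_down a b e \<rho>\<^sub>1"
  proof (rule J_down_greatest)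
    fix fa fb :: nat and \<psi> and e' :: nat and T
    assume \<psi>: "\<psi> \<in> purifications a b e ({..<fa} \<times> {..<fb}) \<rho>\<^sub>1"
      and T: "quantum_operation {..<e} {..<e'} T"
    obtain W where W: "W \<in> isometries {..<f} ({..<fa + f} \<times> {..<fb})" and \<psi>W: "\<psi> = dilate W"
      using purification_is_dilation[OF \<psi>] by blast
    let ?\<sigma> = "relabel (\<lambda>((i, x), (j, y), k). (i, j, k, x, y)) (apply_E_4 T (proj \<psi>))"
    have "?\<sigma> \<in> operators (({..<a} \<times> {..<fa}) \<times> ({..<b} \<times> {..<fb}) \<times> {..<e'})"
      by (rule purification_output_operators[OF \<psi> T])
    \<comment> \<open>\<open>W\<close> lands in the enlarged \<open>F\<^sub>A\<close>, while the
      operator is still supported on the original one; the value bounding \<open>J_down_star\<close>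
      is thus the one occurring in \<open>J_down\<close>.\<close>
    then have "cmi ({..<a} \<times> {..<fa + f}) ({..<b} \<times> {..<fb}) {..<e'} ?\<sigma>
        = cmi ({..<a} \<times> {..<fa}) ({..<b} \<times> {..<fb}) {..<e'} ?\<sigma>"
      by (intro cmi_superset) auto
    then show "J_down_star a b f \<rho>\<^sub>2 \<le> ereal (cmi ({..<a} \<times> {..<fa}) ({..<b} \<times> {..<fb}) {..<e'} ?\<sigma>)"
      using J_down_star_lower[OF W extend_extension[OF T]] unfolding \<psi>W apply_isometry_extend[OF T]
      by simp
  qed
qed

lemma S_J_iff:
  assumes "\<rho>\<^sub>1 \<in> S_all a b e" "\<rho>\<^sub>2 \<in> S_all a b f"
  shows "\<rho>\<^sub>1 \<in> S_J a b e \<longleftrightarrow> \<rho>\<^sub>2 \<in> S_J_star a b f"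
proof
  assume "\<rho>\<^sub>1 \<in> S_J a b e"
  then obtain fa fb :: nat and \<psi> where \<psi>: "\<psi> \<in> purifications a b e ({..<fa} \<times> {..<fb}) \<rho>\<^sub>1"
    and sep: "ptrace (\<lambda>((i, x), (j, y)) k. (i, j, k, x, y)) {..<e} (proj \<psi>)
      \<in> separable_states ({..<a} \<times> {..<fa}) ({..<b} \<times> {..<fb})"
    unfolding S_J_def by blast
  obtain W where W: "W \<in> isometries {..<f} ({..<fa + f} \<times> {..<fb})" and \<psi>W: "\<psi> = dilate W"
    using purification_is_dilation[OF \<psi>] by blast
  \<comment> \<open>The isometry recovered from \<open>\<psi>\<close> has the enlarged
    \<open>F\<^sub>A\<close> as target, so the given decomposition is reread there.\<close>
  have "separable_states ({..<a} \<times> {..<fa}) ({..<b} \<times> {..<fb})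
      \<subseteq> separable_states ({..<a} \<times> {..<fa + f}) ({..<b} \<times> {..<fb})"
    by (rule separable_states_mono) auto
  then have "relabel (\<lambda>((i, x), (j, y)). (i, j, x, y)) (apply_E (induced_map {..<f} W) \<rho>\<^sub>2)
      \<in> separable_states ({..<a} \<times> {..<fa + f}) ({..<b} \<times> {..<fb})"
    using sep unfolding \<psi>W dilate_reduced by blast
  with W show "\<rho>\<^sub>2 \<in> S_J_star a b f"
    using assms(2) unfolding S_J_star_def by blast
next
  assume "\<rho>\<^sub>2 \<in> S_J_star a b f"
  then obtain ea eb W where W: "W \<in> isometries {..<f} ({..<ea::nat} \<times> {..<eb::nat})"
    and sep: "relabel (\<lambda>((i, x), (j, y)). (i, j, x, y)) (apply_E (induced_map {..<f} W) \<rho>\<^sub>2)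
      \<in> separable_states ({..<a} \<times> {..<ea}) ({..<b} \<times> {..<eb})"
    unfolding S_J_star_def by blast
  show "\<rho>\<^sub>1 \<in> S_J a b e"
    using assms(1) dilate_purification[OF W] sep[folded dilate_reduced] unfolding S_J_def by blast
qed

end

theorem proposition6:
  fixes a b e f :: nat
    and \<rho>\<^sub>1 \<rho>\<^sub>2 :: "(nat \<times> nat \<times> nat) op"
    and \<phi>\<^sub>1 \<phi>\<^sub>2 :: "(nat \<times> nat \<times> nat \<times> nat) ket"
  assumes "\<rho>\<^sub>1 \<in> S_all a b e" and "\<rho>\<^sub>2 \<in> S_all a b f"
    and "\<phi>\<^sub>1 \<in> purifications a b e {..<f} \<rho>\<^sub>1"
    and "\<phi>\<^sub>2 \<in> purifications a b f {..<e} \<rho>\<^sub>2"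
    and "swap_EF (proj \<phi>\<^sub>1) = proj \<phi>\<^sub>2"
  shows "I_down a b e \<rho>\<^sub>1 = I_down_star a b f \<rho>\<^sub>2 \<and>
         J_down a b e \<rho>\<^sub>1 = J_down_star a b f \<rho>\<^sub>2 \<and>
         (\<rho>\<^sub>1 \<in> S_I a b e \<longleftrightarrow> \<rho>\<^sub>2 \<in> S_I_star a b f) \<and>
         (\<rho>\<^sub>1 \<in> S_J a b e \<longleftrightarrow> \<rho>\<^sub>2 \<in> S_J_star a b f)"
proof -
  have red1: "ptrace (\<lambda>(i, j, k) l. (i, j, k, l)) {..<f} (proj \<phi>\<^sub>1) = \<rho>\<^sub>1"
    and red2: "ptrace (\<lambda>(i, j, k) l. (i, j, k, l)) {..<e} (proj \<phi>\<^sub>2) = \<rho>\<^sub>2"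
    using assms(3,4) by (simp_all add: purifications_def)
  \<comment> \<open>Equality of projectors fixes the second ket only up to a phase. Reduced states
    are computed from projectors, where the phase cancels.\<close>
  have swap: "proj \<phi>\<^sub>2 (i, j, l, k) (i', j', l', k') = proj \<phi>\<^sub>1 (i, j, k, l) (i', j', k', l')"
    for i j k l i' j' k' l'
    by (simp add: assms(5)[symmetric] swap_EF_def relabel_def)
  interpret swapped_states a b e f \<rho>\<^sub>1 \<rho>\<^sub>2 \<phi>\<^sub>1
  proof
    show "i < a \<and> j < b \<and> k < e \<and> l < f" if "\<phi>\<^sub>1 (i, j, k, l) \<noteq> 0" for i j k l
      using that assms(3) by (fastforce simp: purifications_def unit_kets_def)
    show "\<rho>\<^sub>1 (i, j, k) (i', j', k') = (\<Sum>l<f. \<phi>\<^sub>1 (i, j, k, l) * cnj (\<phi>\<^sub>1 (i', j', k', l)))"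
      for i j k i' j' k'
      by (simp add: red1[symmetric] ptrace_def proj_def)
    show "\<rho>\<^sub>2 (i, j, l) (i', j', l') = (\<Sum>k<e. \<phi>\<^sub>1 (i, j, k, l) * cnj (\<phi>\<^sub>1 (i', j', k, l')))"
      for i j l i' j' l'
      using swap by (simp add: red2[symmetric] ptrace_def) (simp add: proj_def)
  qed (use assms(1,2) in \<open>simp_all add: S_all_def density_ops_def\<close>)
  show ?thesis
    using I_down_eq J_down_eq S_I_iff S_J_iff assms(1,2) by blast
qed

end
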